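(* The random walk on any non-degenerate T-graph is recurrent.
   Context: A T-graph $T\subset\mathbb C$ is a planar graph formed by segments (images of black faces of the triangular lattice $\mathcal H^\dagger$ dual to the hexagonal lattice) and triangular faces similar to a fixed triangle $\Delta$ with angles $\pi p_a,\pi p_b,\pi p_c$ ($p_\bullet\in(0,1)$, sum $1$), obtained as the image of $\mathcal H^\dagger$ under a map $\psi=\psi_{\lambda\Delta}$ depending on $\Delta$ and a unit complex number $\lambda$. It is non-degenerate if no triangle is degenerate to a point and every vertex of $T$ lies in exactly three segments, being an endpoint of two and in the interior of exactly one. Random walk on $T$: the continuous-time Markov process on vertices of $T$ which, from a vertex $v$, with $v^+,v^-$ the endpoints of the unique segment containing $v$ in its interior, jumps to $v^\pm$ at rate $1/|v^\pm-v|$. Recurrent means that the walk started from any vertex returns to it almost surely. *)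

theory Defs
  imports "HOL-Analysis.Analysis"
begin

text \<open>
Conventions.  The triangular lattice (dual of the hexagonal lattice) has vertex set
Z x Z.  Its faces are the "up" triangles {(x,y),(x+1,y),(x,y+1)} (white faces; their
images are triangles similar to Delta) and the "down" triangles
{(x+1,y),(x,y+1),(x+1,y+1)} (black faces; their images are segments).
The triangle Delta has angles pi*pa, pi*pb, pi*pc; we realise it as the triangle with
vertices 0, 1, tB below (angle pi*pa at 0, pi*pb at 1, pi*pc at tB).
\<close>

definition tB :: "real \<Rightarrow> real \<Rightarrow> real \<Rightarrow> complex" where
  "tB pa pb pc = cis (pi * pa) * complex_of_real (sin (pi * pb) / sin (pi * pc))"

definition tmu :: "real \<Rightarrow> real \<Rightarrow> real \<Rightarrow> complex" where
  "tmu pa pb pc = cis (pi * pc)"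

definition tnu :: "real \<Rightarrow> real \<Rightarrow> real \<Rightarrow> complex" where
  "tnu pa pb pc = - cis (- (pi * pb))"

definition teta :: "real \<Rightarrow> real \<Rightarrow> real \<Rightarrow> complex" where
  "teta pa pb pc = (tB pa pb pc - 1) / complex_of_real (cmod (tB pa pb pc - 1))"

definition tzeta :: "real \<Rightarrow> real \<Rightarrow> real \<Rightarrow> complex" where
  "tzeta pa pb pc = (tB pa pb pc - 1) / complex_of_real (cmod (tB pa pb pc - 1))
                    * complex_of_real (cmod (tB pa pb pc)) / tB pa pb pc"

text \<open>Real scale factor of the white triangle at (x,y) (may be negative or zero).\<close>
definition tscale :: "real \<Rightarrow> real \<Rightarrow> real \<Rightarrow> complex \<Rightarrow> int \<Rightarrow> int \<Rightarrow> real" where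
  "tscale pa pb pc lam x y = Re (lam * (tmu pa pb pc) powi x * (tnu pa pb pc) powi y)"

text \<open>Complex similarity factor of the white triangle at (x,y).\<close>
definition tfac :: "real \<Rightarrow> real \<Rightarrow> real \<Rightarrow> complex \<Rightarrow> int \<Rightarrow> int \<Rightarrow> complex" where
  "tfac pa pb pc lam x y = complex_of_real (tscale pa pb pc lam x y)
      * (tzeta pa pb pc) powi x * (teta pa pb pc) powi y"

definition hstep :: "real \<Rightarrow> real \<Rightarrow> real \<Rightarrow> complex \<Rightarrow> int \<Rightarrow> int \<Rightarrow> complex" where
  "hstep pa pb pc lam x y = tfac pa pb pc lam x y"

definition vstep :: "real \<Rightarrow> real \<Rightarrow> real \<Rightarrow> complex \<Rightarrow> int \<Rightarrow> int \<Rightarrow> complex" where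
  "vstep pa pb pc lam x y = tfac pa pb pc lam x y * tB pa pb pc"

text \<open>The map psi = psi_{lambda Delta} (normalised by psi(0,0) = 0):
  psi(x+1,y) - psi(x,y) = hstep x y and psi(x,y+1) - psi(x,y) = vstep x y.\<close>
definition tpsi :: "real \<Rightarrow> real \<Rightarrow> real \<Rightarrow> complex \<Rightarrow> int \<times> int \<Rightarrow> complex" where
  "tpsi pa pb pc lam = (\<lambda>(x, y).
      (\<Sum>k\<in>{0..<x}. hstep pa pb pc lam k 0) - (\<Sum>k\<in>{x..<0}. hstep pa pb pc lam k 0)
    + (\<Sum>k\<in>{0..<y}. vstep pa pb pc lam x k) - (\<Sum>k\<in>{y..<0}. vstep pa pb pc lam x k))"

text \<open>Image of the black (down) face at (x,y): a segment.\<close>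
definition tseg :: "real \<Rightarrow> real \<Rightarrow> real \<Rightarrow> complex \<Rightarrow> int \<times> int \<Rightarrow> complex set" where
  "tseg pa pb pc lam = (\<lambda>(x, y). convex hull
      {tpsi pa pb pc lam (x+1, y), tpsi pa pb pc lam (x, y+1), tpsi pa pb pc lam (x+1, y+1)})"

definition tsegments :: "real \<Rightarrow> real \<Rightarrow> real \<Rightarrow> complex \<Rightarrow> complex set set" where
  "tsegments pa pb pc lam = range (tseg pa pb pc lam)"

definition tvertices :: "real \<Rightarrow> real \<Rightarrow> real \<Rightarrow> complex \<Rightarrow> complex set" where
  "tvertices pa pb pc lam = range (tpsi pa pb pc lam)"

definition seg_interior :: "complex set \<Rightarrow> complex set" where
  "seg_interior S = {v \<in> S. \<not> v extreme_point_of S}"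

definition nondegenerate_tgraph :: "real \<Rightarrow> real \<Rightarrow> real \<Rightarrow> complex \<Rightarrow> bool" where
  "nondegenerate_tgraph pa pb pc lam \<longleftrightarrow>
     (\<forall>x y. \<not> (tpsi pa pb pc lam (x, y) = tpsi pa pb pc lam (x+1, y)
               \<and> tpsi pa pb pc lam (x, y) = tpsi pa pb pc lam (x, y+1)))
   \<and> (\<forall>v \<in> tvertices pa pb pc lam.
        card {S \<in> tsegments pa pb pc lam. v \<in> S} = 3
      \<and> card {S \<in> tsegments pa pb pc lam. v extreme_point_of S} = 2
      \<and> card {S \<in> tsegments pa pb pc lam. v \<in> seg_interior S} = 1)"

definition tcarrier :: "real \<Rightarrow> real \<Rightarrow> real \<Rightarrow> complex \<Rightarrow> complex \<Rightarrow> complex set" where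
  "tcarrier pa pb pc lam v = (THE S. S \<in> tsegments pa pb pc lam \<and> v \<in> seg_interior S)"

definition tnbrs :: "real \<Rightarrow> real \<Rightarrow> real \<Rightarrow> complex \<Rightarrow> complex \<Rightarrow> complex set" where
  "tnbrs pa pb pc lam v = {w. w extreme_point_of tcarrier pa pb pc lam v}"

definition trate :: "real \<Rightarrow> real \<Rightarrow> real \<Rightarrow> complex \<Rightarrow> complex \<Rightarrow> complex \<Rightarrow> real" where
  "trate pa pb pc lam v w = (if w \<in> tnbrs pa pb pc lam v then 1 / cmod (w - v) else 0)"

text \<open>Transition probabilities of the embedded jump chain.\<close>
definition tjump :: "real \<Rightarrow> real \<Rightarrow> real \<Rightarrow> complex \<Rightarrow> complex \<Rightarrow> complex \<Rightarrow> real" where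
  "tjump pa pb pc lam v w = trate pa pb pc lam v w
      / (\<Sum>u\<in>tnbrs pa pb pc lam v. trate pa pb pc lam v u)"

text \<open>Generic discrete-time chain with transition kernel P and finite neighbour sets N:
  taboo P N v n u = probability, starting at u, to be at v for the first time at step n.\<close>
fun taboo :: "('a \<Rightarrow> 'a \<Rightarrow> real) \<Rightarrow> ('a \<Rightarrow> 'a set) \<Rightarrow> 'a \<Rightarrow> nat \<Rightarrow> 'a \<Rightarrow> real" where
  "taboo P N v 0 u = (if u = v then 1 else 0)"
| "taboo P N v (Suc n) u = (if u = v then 0 else (\<Sum>w\<in>N u. P u w * taboo P N v n w))"

definition return_prob :: "('a \<Rightarrow> 'a \<Rightarrow> real) \<Rightarrow> ('a \<Rightarrow> 'a set) \<Rightarrow> 'a \<Rightarrow> real" where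
  "return_prob P N v = (\<Sum>n. \<Sum>w\<in>N v. P v w * taboo P N v n w)"

definition tgraph_walk_recurrent :: "real \<Rightarrow> real \<Rightarrow> real \<Rightarrow> complex \<Rightarrow> bool" where
  "tgraph_walk_recurrent pa pb pc lam \<longleftrightarrow>
     (\<forall>v \<in> tvertices pa pb pc lam.
        return_prob (tjump pa pb pc lam) (tnbrs pa pb pc lam) v = 1)"

end

theory Submission
  imports Defs
begin

text \<open>
The lattice map is explicit: \<open>tpsi\<close> is a linear embedding of \<open>Z^2\<close> plus a bounded quasi-periodic
oscillation. The walk is a planar martingale moving along segments of length bounded above and
below. Its quadratic variation is anisotropic, but the anisotropy \<open>length * u^2\<close> is the image under
the generator of a bounded function (the corrector), because the T-graph carries an explicit
harmonic function at bounded distance from \<open>z^2\<close>. Correcting \<open>ln |z|^2 - |z|^(-1/2)\<close> accordingly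
gives a proper function that is superharmonic outside a finite set.

For irreducibility, which two neighbours a vertex jumps to depends only on the fractional part of
the phase \<open>phase0 + pc * x - pb * y\<close>. Vertices with phase near an integer \<open>k\<close> form a single directed
lattice path going up-right; the vertices in the bands between consecutive paths move down-left, and
zig-zagging between a band and the path \<open>k\<close> one gets arbitrarily far back on that path.
\<close>

section \<open>Recurrence from a Lyapunov function\<close>

text \<open>The bare logarithm fails for two reasons. A jump along a segment of direction
  \<open>u\<close> sees only the second derivative in that direction: half the Laplacian plus an
  oscillating term of order |z|^(-2). That term depends on \<open>u\<close>, has no sign at a single
  vertex, and dominates the Taylor remainders of order |z|^(-3); it must be cancelled exactly, not
  estimated. Once it is gone, the Laplacian of the logarithm is zero and the remainders have no sign
  either; the extra - |z|^(-1/2) supplies a negative drift of order |z|^(-5/2), which beats them far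
  out. Single jumps may be very short, so the estimates after division by the jump lengths
  \<open>s\<close> and \<open>t\<close> use upper bounds for \<open>s\<close> and \<open>t\<close>
  and a lower bound for \<open>s + t\<close>. Non-degeneracy enters through nonzero scales, which
  keep all phases off the integers, and through the uniqueness of the segment having a given vertex
  in its interior.\<close>

lemma weighted_avg_le_max:
  fixes p F :: "'a \<Rightarrow> real"
  assumes "finite S" "\<And>w. w \<in> S \<Longrightarrow> p w > 0" "sum p S = 1"
    and "\<And>w. w \<in> S \<Longrightarrow> F w \<le> M" "M \<le> (\<Sum>w\<in>S. p w * F w)" "w \<in> S"
  shows "F w = M"
proof (rule ccontr)
  assume "F w \<noteq> M"
  with assms(4,6) have "F w < M" by fastforce
  have "(\<Sum>w\<in>S. p w * F w) < (\<Sum>w\<in>S. p w * M)"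
    using assms \<open>F w < M\<close> by (intro sum_strict_mono_ex1) (auto simp: less_imp_le)
  also have "\<dots> = M" using assms(3) by (simp add: sum_distrib_right[symmetric])
  finally show False using assms(5) by simp
qed

locale positive_chain =
  fixes P :: "'a \<Rightarrow> 'a \<Rightarrow> real" and N :: "'a \<Rightarrow> 'a set" and V :: "'a set"
  assumes finite_nbrs: "u \<in> V \<Longrightarrow> finite (N u)"
    and nbrs_closed: "u \<in> V \<Longrightarrow> N u \<subseteq> V"
    and kernel_pos: "u \<in> V \<Longrightarrow> w \<in> N u \<Longrightarrow> P u w > 0"
    and kernel_sum: "u \<in> V \<Longrightarrow> sum (P u) (N u) = 1"
    and irreducible: "u \<in> V \<Longrightarrow> v \<in> V \<Longrightarrow> (u, v) \<in> {(u, w). w \<in> N u}\<^sup>*"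
begin

text \<open>Off \<open>A\<close> the averaging inequality forces every neighbour of a maximum point
  to be one too. Along a directed path from \<open>u\<close> to \<open>v\<close> the maximum
  survives until the path first meets \<open>A\<close>, at the latest at \<open>v\<close>.\<close>

lemma subharmonic_max_attained:
  assumes "u \<in> V" "\<And>w. w \<in> V \<Longrightarrow> F w \<le> F u"
    and sub: "\<And>w. w \<in> V - A \<Longrightarrow> F w \<le> (\<Sum>x\<in>N w. P w x * F x)"
    and v: "v \<in> A" "v \<in> V"
  obtains a where "a \<in> A" "a \<in> V" "F a = F u"
proof -
  have "w \<in> V \<Longrightarrow> F w = F u \<Longrightarrow> \<exists>a\<in>A \<inter> V. F a = F u" if "(w, v) \<in> {(u, w). w \<in> N u}\<^sup>*" for w
    using that
  proof (induction rule: converse_rtrancl_induct)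
    case base then show ?case using v by auto
  next
    case (step y z)
    show ?case
    proof (cases "y \<in> A")
      case True then show ?thesis using step by auto
    next
      case False
      have "z \<in> N y" using step by simp
      moreover have "F u \<le> (\<Sum>x\<in>N y. P y x * F x)" using sub[of y] False step.prems by simp
      moreover have "F x \<le> F u" if "x \<in> N y" for x
        using assms(2) nbrs_closed[of y] step.prems that by blast
      ultimately have "F z = F u"
        using weighted_avg_le_max[of "N y" "P y" F "F u" z] finite_nbrs[of y] kernel_pos[of y]
          kernel_sum[of y] step.prems by blast
      then show ?thesis using step \<open>z \<in> N y\<close> nbrs_closed by blast
    qed
  qed
  then show ?thesis using that irreducible[OF \<open>u \<in> V\<close> \<open>v \<in> V\<close>] \<open>u \<in> V\<close> by blast
qed

lemma taboo_nonneg: "u \<in> V \<Longrightarrow> 0 \<le> taboo P N v n u"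
proof (induction n arbitrary: u)
  case (Suc n)
  have "0 \<le> P u w * taboo P N v n w" if "w \<in> N u" for w
    using Suc that nbrs_closed by (intro mult_nonneg_nonneg less_imp_le[OF kernel_pos]) auto
  then show ?case by (auto intro: sum_nonneg)
qed simp

lemma taboo_target: "taboo P N v n v = (if n = 0 then 1 else 0)"
  by (cases n) auto

lemma taboo_sum_Suc:
  assumes "u \<noteq> v"
  shows "(\<Sum>k<Suc n. taboo P N v k u) = (\<Sum>w\<in>N u. P u w * (\<Sum>k<n. taboo P N v k w))"
proof -
  have "(\<Sum>k<Suc n. taboo P N v k u) = (\<Sum>k<n. \<Sum>w\<in>N u. P u w * taboo P N v k w)"
    using assms by (subst sum.lessThan_Suc_shift) simp
  also have "\<dots> = (\<Sum>w\<in>N u. P u w * (\<Sum>k<n. taboo P N v k w))"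
    by (subst sum.swap) (simp add: sum_distrib_left)
  finally show ?thesis .
qed

lemma taboo_sum_le_1: "u \<in> V \<Longrightarrow> (\<Sum>k<n. taboo P N v k u) \<le> 1"
proof (induction n arbitrary: u)
  case (Suc n)
  show ?case
  proof (cases "u = v")
    case True
    then show ?thesis by (simp add: taboo_target sum.lessThan_Suc_shift del: sum.lessThan_Suc)
  next
    case False
    have "(\<Sum>w\<in>N u. P u w * (\<Sum>k<n. taboo P N v k w)) \<le> (\<Sum>w\<in>N u. P u w * 1)"
      using Suc nbrs_closed[of u] kernel_pos[of u]
      by (intro sum_mono mult_left_mono) (auto simp: less_imp_le)
    then show ?thesis using taboo_sum_Suc[OF False] kernel_sum[OF Suc.prems] by simp
  qed
qed simp

lemma taboo_summable: "u \<in> V \<Longrightarrow> summable (\<lambda>n. taboo P N v n u)"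
  by (rule bounded_imp_summable[where B = 1])
    (auto simp: taboo_nonneg taboo_sum_le_1 lessThan_Suc_atMost[symmetric] simp del: sum.lessThan_Suc)

text \<open>Probability of ever visiting \<open>v\<close>, time 0 included.
  \<open>return_prob\<close> forces a first step and is therefore the average of
  \<open>hit v\<close> over the neighbours of \<open>v\<close>.\<close>

definition hit :: "'a \<Rightarrow> 'a \<Rightarrow> real" where
  "hit v u = (\<Sum>n. taboo P N v n u)"

lemma hit_bounds: "u \<in> V \<Longrightarrow> 0 \<le> hit v u" "u \<in> V \<Longrightarrow> hit v u \<le> 1"
  unfolding hit_def
  by (auto intro!: suminf_nonneg suminf_le_const taboo_summable taboo_nonneg taboo_sum_le_1)

lemma hit_target: "hit v v = 1"
proof -
  have "hit v v = (\<Sum>n\<in>{0}. taboo P N v n v)"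
    unfolding hit_def by (rule suminf_finite) (auto simp: taboo_target)
  then show ?thesis by simp
qed

lemma step_hit_eq_suminf:
  assumes "u \<in> V"
  shows "(\<Sum>w\<in>N u. P u w * hit v w) = (\<Sum>n. \<Sum>w\<in>N u. P u w * taboo P N v n w)"
proof -
  have s: "summable (\<lambda>n. P u w * taboo P N v n w)" if "w \<in> N u" for w
    using that assms nbrs_closed by (intro summable_mult taboo_summable) blast
  have "(\<Sum>n. \<Sum>w\<in>N u. P u w * taboo P N v n w) = (\<Sum>w\<in>N u. \<Sum>n. P u w * taboo P N v n w)"
    by (rule suminf_sum) (use s in auto)
  also have "\<dots> = (\<Sum>w\<in>N u. P u w * hit v w)"
    unfolding hit_def using assms nbrs_closed
    by (intro sum.cong refl suminf_mult taboo_summable) blast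
  finally show ?thesis by simp
qed

lemma hit_harmonic:
  assumes "u \<in> V" "u \<noteq> v"
  shows "hit v u = (\<Sum>w\<in>N u. P u w * hit v w)"
proof -
  have "hit v u = (\<Sum>n. taboo P N v (Suc n) u) + taboo P N v 0 u"
    unfolding hit_def using suminf_split_head[OF taboo_summable[OF assms(1)], of v] by linarith
  also have "\<dots> = (\<Sum>w\<in>N u. P u w * hit v w)"
    unfolding step_hit_eq_suminf[OF assms(1)] using assms(2) by simp
  finally show ?thesis .
qed

text \<open>The escape probability \<open>1 - hit v\<close> is bounded and harmonic off \<open>v\<close>; subtracting a small
  multiple of the Lyapunov function makes the maximum principle applicable, so its supremum is
  attained on a finite set, and irreducibility carries that value to \<open>v\<close>, where it vanishes.\<close>

theorem lyapunov_recurrence: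
  assumes "finite A" and sublevel: "\<And>K. finite {u \<in> V. h u \<le> K}"
    and super: "\<And>u. u \<in> V - A \<Longrightarrow> (\<Sum>w\<in>N u. P u w * h w) \<le> h u"
    and v: "v \<in> V"
  shows "return_prob P N v = 1"
proof -
  define g where "g u = 1 - hit v u" for u
  \<comment> \<open>Adding \<open>v\<close> makes the set nonempty and removes the vertex where
    \<open>g\<close> need not be harmonic.\<close>
  define A' where "A' = insert v (A \<inter> V)"
  have fA: "finite A'" "A' \<noteq> {}" "A' \<subseteq> V" using assms by (auto simp: A'_def)
  have g: "0 \<le> g u" "g u \<le> 1" if "u \<in> V" for u
    using hit_bounds[OF that] by (auto simp: g_def)
  have gharm: "g u = (\<Sum>w\<in>N u. P u w * g w)" if "u \<in> V" "u \<noteq> v" for u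
    using hit_harmonic[OF that] kernel_sum[OF that(1)]
    by (simp add: g_def right_diff_distrib sum_subtractf)
  define m where "m = Max (g ` A')"
  have m: "g a \<le> m" if "a \<in> A'" for a using that fA by (auto simp: m_def)
  define l where "l = Min (h ` A')"
  have l: "l \<le> h a" if "a \<in> A'" for a using that fA by (auto simp: l_def)
  have gm: "g u \<le> m" if u: "u \<in> V" for u
  proof -
    have eps: "g u \<le> m + e * (h u - l)" if e: "e > 0" for e
    proof -
      define F where "F w = g w - e * h w" for w
      \<comment> \<open>As \<open>g\<close> ranges in [0, 1], raising \<open>h\<close> by more than
        \<open>1 / e\<close> costs more than \<open>g\<close> can gain: outside this finite set
        \<open>F\<close> does not exceed \<open>F u\<close>.\<close>
      define S where "S = {w \<in> V. h w \<le> h u + 1 / e}"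
      have S: "finite S" "u \<in> S" using sublevel u e by (auto simp: S_def)
      obtain y where y: "y \<in> S" "\<And>w. w \<in> S \<Longrightarrow> F w \<le> F y"
        using S finite_imageI[of S F] Max_ge[of "F ` S"] Max_in[of "F ` S"] by fastforce
      have ymax: "F w \<le> F y" if w: "w \<in> V" for w
      proof (cases "w \<in> S")
        case False
        then have "1 / e < h w - h u" using w by (simp add: S_def)
        then have "1 < e * (h w - h u)" using e by (simp add: field_simps)
        then have "F w \<le> F u" using g[OF w] g[OF u] by (simp add: F_def algebra_simps)
        also have "\<dots> \<le> F y" using y S by simp
        finally show ?thesis .
      qed (use y in auto)
      have "F w \<le> (\<Sum>x\<in>N w. P w x * F x)" if w: "w \<in> V - A'" for w
      proof -
        have "(\<Sum>x\<in>N w. P w x * F x) = g w - e * (\<Sum>x\<in>N w. P w x * h x)"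
          using gharm[of w] w
          by (simp add: F_def A'_def right_diff_distrib sum_subtractf sum_distrib_left mult.left_commute)
        moreover have "e * (\<Sum>x\<in>N w. P w x * h x) \<le> e * h w"
          using super[of w] w e by (intro mult_left_mono) (auto simp: A'_def)
        ultimately show ?thesis by (simp add: F_def)
      qed
      moreover have "y \<in> V" "v \<in> A'" using y by (auto simp: S_def A'_def)
      ultimately obtain a where a: "a \<in> A'" "F a = F y"
        using subharmonic_max_attained[of y F A' v] ymax v by metis
      have "F u \<le> F a" using ymax[OF u] a by simp
      moreover have "e * l \<le> e * h a" using l[OF a(1)] e by simp
      ultimately show ?thesis using m[OF a(1)] by (simp add: F_def algebra_simps)
    qed
    show ?thesis
    proof (rule field_le_epsilon)
      fix d :: real assume d: "d > 0"
      define e where "e = d / (\<bar>h u - l\<bar> + 1)"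
      have "e > 0" using d by (simp add: e_def)
      have "e * (h u - l) \<le> e * (\<bar>h u - l\<bar> + 1)" using \<open>e > 0\<close> by (intro mult_left_mono) auto
      also have "\<dots> = d" by (simp add: e_def)
      finally show "g u \<le> m + d" using eps[OF \<open>e > 0\<close>] by simp
    qed
  qed
  have "m \<in> g ` A'" unfolding m_def using fA by (intro Max_in) auto
  then obtain u where u: "u \<in> A'" "g u = m" by auto
  have "u \<in> V" "\<And>w. w \<in> V \<Longrightarrow> g w \<le> g u" using u gm fA by auto
  moreover have "g w \<le> (\<Sum>x\<in>N w. P w x * g x)" if "w \<in> V - {v}" for w
    using gharm[of w] that by simp
  ultimately obtain a where "a \<in> {v}" "g a = g u"
    using subharmonic_max_attained[of u g "{v}" v] v by blast
  then have "m = 0" using u by (simp add: g_def hit_target)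
  then have "hit v w = 1" if "w \<in> V" for w
    using gm[OF that] g[OF that] by (simp add: g_def)
  then have "(\<Sum>w\<in>N v. P v w * hit v w) = (\<Sum>w\<in>N v. P v w)"
    using nbrs_closed[OF v] by (intro sum.cong) auto
  then show ?thesis
    using step_hit_eq_suminf[OF v] kernel_sum[OF v] by (simp add: return_prob_def)
qed

end

section \<open>Irreducibility of the phase-driven walk\<close>

text \<open>\<open>R\<close> will be the set of sites reachable from a fixed one. In
  \<open>step1\<close> and \<open>step2\<close> one move stays on path \<open>k\<close> and raises
  \<open>x + y\<close> by one, the other keeps \<open>x + y\<close> and changes the phase by
  \<open>b + c\<close>; in \<open>step3\<close> both moves lower \<open>x + y\<close> by one. So
  \<open>x + y\<close> measures the position along a path.\<close>

locale phase_steps =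
  fixes b c \<phi> :: real and R :: "(int \<times> int) set" and ph :: "int \<Rightarrow> int \<Rightarrow> real"
  defines "ph \<equiv> \<lambda>x y. \<phi> + c * of_int x - b * of_int y"
  assumes b: "0 < b" and c: "0 < c" and bc: "b + c < 1"
    and ph_nonint: "\<And>x y k. ph x y \<noteq> of_int k"
    and step1: "\<And>x y k. (x, y) \<in> R \<Longrightarrow> of_int k < ph x y \<Longrightarrow> ph x y < of_int k + c
        \<Longrightarrow> (x - 1, y + 1) \<in> R \<and> (x, y + 1) \<in> R"
    and step2: "\<And>x y k. (x, y) \<in> R \<Longrightarrow> of_int k - b < ph x y \<Longrightarrow> ph x y < of_int k
        \<Longrightarrow> (x + 1, y - 1) \<in> R \<and> (x + 1, y) \<in> R"
    and step3: "\<And>x y k. (x, y) \<in> R \<Longrightarrow> of_int k + c < ph x y \<Longrightarrow> ph x y < of_int k + 1 - b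
        \<Longrightarrow> (x, y - 1) \<in> R \<and> (x - 1, y) \<in> R"
begin

lemma ph_shift [simp]:
  "ph (x + 1) y = ph x y + c" "ph (x - 1) y = ph x y - c"
  "ph x (y + 1) = ph x y - b" "ph x (y - 1) = ph x y + b"
  by (simp_all add: ph_def algebra_simps)

lemma ph_ne: "ph x y \<noteq> of_int k" "ph x y \<noteq> of_int k + c" "ph x y \<noteq> of_int k - b"
proof -
  show "ph x y \<noteq> of_int k" by (rule ph_nonint)
  show "ph x y \<noteq> of_int k + c" using ph_nonint[of "x - 1" y k] by simp
  show "ph x y \<noteq> of_int k - b" using ph_nonint[of x "y - 1" k] by simp
qed

text \<open>Inside a band, repeat \<open>y - 1\<close>; at each intermediate path the diagonal move
  jumps across without changing \<open>x + y\<close>. Every move raises the phase by at least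
  \<open>b\<close>, hence the induction on the missing phase in units of \<open>b\<close>.\<close>

lemma ascend:
  assumes "(x, y) \<in> R" "of_int j + c < ph x y" "ph x y < of_int j + 1" "j < k"
  shows "\<exists>x' y'. (x', y') \<in> R \<and> of_int k - b < ph x' y' \<and> ph x' y' < of_int k
    \<and> x' + y' \<le> x + y \<and> (ph x y < of_int j + 1 - b \<longrightarrow> x' + y' < x + y)"
proof -
  have "\<forall>x y j. (x, y) \<in> R \<longrightarrow> of_int j + c < ph x y \<longrightarrow> ph x y < of_int j + 1 \<longrightarrow> j < k
    \<longrightarrow> of_int k - ph x y < real n * b \<longrightarrow> (\<exists>x' y'. (x', y') \<in> R \<and> of_int k - b < ph x' y' \<and> ph x' y' < of_int k
    \<and> x' + y' \<le> x + y \<and> (ph x y < of_int j + 1 - b \<longrightarrow> x' + y' < x + y))" for n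
  proof (induction n)
    case 0
    show ?case
    proof (intro allI impI)
      fix x y j assume "ph x y < of_int j + 1" "j < k" "of_int k - ph x y < real 0 * b"
      moreover from \<open>j < k\<close> have "of_int j + 1 \<le> (of_int k :: real)" by linarith
      ultimately show "\<exists>x' y'. (x', y') \<in> R \<and> of_int k - b < ph x' y' \<and> ph x' y' < of_int k
         \<and> x' + y' \<le> x + y \<and> (ph x y < of_int j + 1 - b \<longrightarrow> x' + y' < x + y)" by linarith
    qed
  next
    case (Suc n)
    show ?case
    proof (intro allI impI)
      fix x y j assume A: "(x, y) \<in> R" "of_int j + c < ph x y" "ph x y < of_int j + 1" "j < k"
        "of_int k - ph x y < real (Suc n) * b"
      from \<open>j < k\<close> have jk: "of_int j + 1 \<le> (of_int k :: real)" by linarith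
      have n: "of_int k - (ph x y + b) < real n * b" using A(5) by (simp add: algebra_simps)
      show "\<exists>x' y'. (x', y') \<in> R \<and> of_int k - b < ph x' y' \<and> ph x' y' < of_int k
         \<and> x' + y' \<le> x + y \<and> (ph x y < of_int j + 1 - b \<longrightarrow> x' + y' < x + y)"
      proof (cases "ph x y < of_int j + 1 - b")
        case True
        have "(x, y - 1) \<in> R" using step3[OF A(1,2) True] by simp
        moreover have "of_int j + c < ph x (y - 1)" "ph x (y - 1) < of_int j + 1"
          "of_int k - ph x (y - 1) < real n * b"
          using A True n b by auto
        ultimately obtain x' y' where "(x', y') \<in> R" "of_int k - b < ph x' y'" "ph x' y' < of_int k"
          "x' + y' \<le> x + (y - 1)" using Suc.IH A(4) by blast
        then show ?thesis by (intro exI[of _ x'] exI[of _ y']) auto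
      next
        case False
        with ph_ne(3)[of x y "j + 1"] have F: "of_int (j + 1) - b < ph x y" by simp
        show ?thesis
        proof (cases "j + 1 = k")
          case True
          then show ?thesis using A F False by (intro exI[of _ x] exI[of _ y]) auto
        next
          case jn: False
          have "(x + 1, y - 1) \<in> R" using step2[OF A(1) F] A by simp
          moreover have "of_int (j + 1) + c < ph (x + 1) (y - 1)" "ph (x + 1) (y - 1) < of_int (j + 1) + 1"
            "of_int k - ph (x + 1) (y - 1) < real n * b"
            using A F n b c bc by auto
          ultimately obtain x' y' where "(x', y') \<in> R" "of_int k - b < ph x' y'" "ph x' y' < of_int k"
            "x' + y' \<le> x + 1 + (y - 1)" using Suc.IH[rule_format, of "x + 1" "y - 1" "j + 1"] A(4) jn by auto
          then show ?thesis using False by (intro exI[of _ x'] exI[of _ y']) auto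
        qed
      qed
    qed
  qed
  moreover obtain n where "of_int k - ph x y < real n * b"
    using reals_Archimedean3[OF b] by blast
  ultimately show ?thesis using assms by blast
qed

text \<open>The diagonal move lowers the phase by \<open>b + c = 1 - a\<close>, so the offset above
  the next lower integer grows by \<open>a\<close>. An offset below \<open>c\<close> becomes one
  below \<open>c + a = 1 - b\<close>: the band is never overshot, and finitely many moves reach
  it.\<close>

lemma leave_path_down:
  assumes "(x, y) \<in> R" "of_int k < ph x y" "ph x y < of_int k + c"
  shows "\<exists>x' y' j. (x', y') \<in> R \<and> of_int j + c < ph x' y' \<and> ph x' y' < of_int j + 1 - b
    \<and> j < k \<and> x' + y' = x + y"
proof -
  define a where "a = 1 - b - c"
  have a: "a > 0" using bc by (simp add: a_def)
  have "\<forall>x y k. (x, y) \<in> R \<longrightarrow> of_int k < ph x y \<longrightarrow> ph x y < of_int k + c \<longrightarrow> of_int k + c - ph x y < real n * a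
    \<longrightarrow> (\<exists>x' y' j. (x', y') \<in> R \<and> of_int j + c < ph x' y' \<and> ph x' y' < of_int j + 1 - b
    \<and> j < k \<and> x' + y' = x + y)" for n
  proof (induction n)
    case (Suc n)
    show ?case
    proof (intro allI impI)
      fix x y k assume A: "(x, y) \<in> R" "of_int k < ph x y" "ph x y < of_int k + c"
        "of_int k + c - ph x y < real (Suc n) * a"
      have r: "(x - 1, y + 1) \<in> R" using step1[OF A(1-3)] by simp
      have p: "ph (x - 1) (y + 1) = ph x y + a - 1" by (simp add: a_def)
      show "\<exists>x' y' j. (x', y') \<in> R \<and> of_int j + c < ph x' y' \<and> ph x' y' < of_int j + 1 - b
        \<and> j < k \<and> x' + y' = x + y"
      proof (cases "of_int (k - 1) + c < ph (x - 1) (y + 1)")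
        case True
        then show ?thesis using r A bc
          by (intro exI[of _ "x - 1"] exI[of _ "y + 1"] exI[of _ "k - 1"]) auto
      next
        case False
        with ph_ne(2)[of "x - 1" "y + 1" "k - 1"]
        have "ph (x - 1) (y + 1) < of_int (k - 1) + c" by linarith
        moreover have "of_int (k - 1) < ph (x - 1) (y + 1)" using p a A by simp
        moreover have "of_int (k - 1) + c - ph (x - 1) (y + 1) < real n * a"
          unfolding p using A(4) by (simp add: algebra_simps)
        ultimately obtain x' y' j where "(x', y') \<in> R" "of_int j + c < ph x' y'" "ph x' y' < of_int j + 1 - b"
          "j < k - 1" "x' + y' = x - 1 + (y + 1)" using Suc.IH r by blast
        then show ?thesis by (intro exI[of _ x'] exI[of _ y'] exI[of _ j]) auto
      qed
    qed
  qed auto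
  moreover obtain n where "of_int k + c - ph x y < real n * a"
    using reals_Archimedean3[OF a] by blast
  ultimately show ?thesis using assms by blast
qed

end

text \<open>The reflection \<open>(x, y) \<mapsto> (y, x)\<close> exchanges \<open>b\<close> with \<open>c\<close> and negates the phase.\<close>

lemma phase_steps_swap:
  assumes "phase_steps b c \<phi> R"
  shows "phase_steps c b (- \<phi>) (prod.swap ` R)"
proof -
  interpret phase_steps b c \<phi> R "\<lambda>x y. \<phi> + c * of_int x - b * of_int y"
    by (rule assms) simp
  have mem: "(x, y) \<in> prod.swap ` R \<longleftrightarrow> (y, x) \<in> R" for x y by force
  have eq: "- \<phi> + b * real_of_int x - c * of_int y = - (\<phi> + c * of_int y - b * of_int x)" for x y by simp
  show ?thesis
  proof (unfold_locales, unfold mem eq)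
    show "0 < c" "0 < b" "c + b < 1" using b c bc by auto
    show "- (\<phi> + c * of_int y - b * of_int x) \<noteq> of_int k" for x y k
      using ph_nonint[of y x "- k"] by simp
    show "(y + 1, x - 1) \<in> R \<and> (y + 1, x) \<in> R"
      if "(y, x) \<in> R" "of_int k < - (\<phi> + c * of_int y - b * of_int x)" "- (\<phi> + c * of_int y - b * of_int x) < of_int k + b" for x y k
      using step2[of y x "- k"] that by simp
    show "(y - 1, x + 1) \<in> R \<and> (y, x + 1) \<in> R"
      if "(y, x) \<in> R" "of_int k - c < - (\<phi> + c * of_int y - b * of_int x)" "- (\<phi> + c * of_int y - b * of_int x) < of_int k" for x y k
      using step1[of y x "- k"] that by simp
    show "(y - 1, x) \<in> R \<and> (y, x - 1) \<in> R"
      if "(y, x) \<in> R" "of_int k + b < - (\<phi> + c * of_int y - b * of_int x)" "- (\<phi> + c * of_int y - b * of_int x) < of_int k + 1 - c" for x y k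
      using step3[of y x "- k - 1"] that by simp
  qed
qed

context phase_steps
begin

lemma descend:
  assumes "(x, y) \<in> R" "of_int j < ph x y" "ph x y < of_int j + 1 - b" "k \<le> j"
  shows "\<exists>x' y'. (x', y') \<in> R \<and> of_int k < ph x' y' \<and> ph x' y' < of_int k + c
    \<and> x' + y' \<le> x + y \<and> (of_int j + c < ph x y \<longrightarrow> x' + y' < x + y)"
proof -
  interpret sw: phase_steps c b "- \<phi>" "prod.swap ` R" "\<lambda>x y. - \<phi> + b * of_int x - c * of_int y"
    using phase_steps_swap[of b c \<phi> R] phase_steps_axioms by (simp_all add: ph_def)
  have eq: "- \<phi> + b * real_of_int x - c * of_int y = - ph y x" for x y by (simp add: ph_def)
  have mem: "(x, y) \<in> prod.swap ` R \<longleftrightarrow> (y, x) \<in> R" for x y by force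
  \<comment> \<open>Negating the phase turns the band between \<open>j\<close> and
    \<open>j + 1\<close> into the one between \<open>- j - 1\<close> and \<open>- j\<close>.\<close>
  obtain x' y' where "(y', x') \<in> R" "of_int (- k) - c < - ph y' x'" "- ph y' x' < of_int (- k)"
     "x' + y' \<le> y + x" "- ph x y < of_int (- j - 1) + 1 - c \<longrightarrow> x' + y' < y + x"
    using sw.ascend[of y x "- j - 1" "- k", unfolded eq mem] assms by auto
  then show ?thesis by (intro exI[of _ y'] exI[of _ x']) auto
qed

lemma leave_path_up:
  assumes "(x, y) \<in> R" "of_int k - b < ph x y" "ph x y < of_int k"
  shows "\<exists>x' y' j. (x', y') \<in> R \<and> of_int j + c < ph x' y' \<and> ph x' y' < of_int j + 1 - b
    \<and> k \<le> j \<and> x' + y' = x + y"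
proof -
  interpret sw: phase_steps c b "- \<phi>" "prod.swap ` R" "\<lambda>x y. - \<phi> + b * of_int x - c * of_int y"
    using phase_steps_swap[of b c \<phi> R] phase_steps_axioms by (simp_all add: ph_def)
  have eq: "- \<phi> + b * real_of_int x - c * of_int y = - ph y x" for x y by (simp add: ph_def)
  have mem: "(x, y) \<in> prod.swap ` R \<longleftrightarrow> (y, x) \<in> R" for x y by force
  obtain x' y' j where "(y', x') \<in> R" "of_int j + b < - ph y' x'" "- ph y' x' < of_int j + 1 - c"
     "j < - k" "x' + y' = y + x"
    using sw.leave_path_down[of y x "- k", unfolded eq mem] assms by auto
  then show ?thesis by (intro exI[of _ y'] exI[of _ x'] exI[of _ "- j - 1"]) auto
qed

definition on_path :: "int \<Rightarrow> int \<Rightarrow> int \<Rightarrow> bool" where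
  "on_path k x y \<longleftrightarrow> of_int k - b < ph x y \<and> ph x y < of_int k + c"

text \<open>The diagonal moves that leave and cross paths preserve \<open>x + y\<close>, while a
  band step lowers it; returning through a band therefore lands strictly further back.\<close>

lemma path_go_back:
  assumes "(x, y) \<in> R" "on_path k x y"
  shows "\<exists>x' y'. (x', y') \<in> R \<and> on_path k x' y' \<and> x' + y' < x + y"
proof (cases "of_int k < ph x y")
  case True
  obtain x1 y1 j where 1: "(x1, y1) \<in> R" "of_int j + c < ph x1 y1" "ph x1 y1 < of_int j + 1 - b"
    "j < k" "x1 + y1 = x + y"
    using leave_path_down[OF assms(1) True] assms(2) by (auto simp: on_path_def)
  then obtain x2 y2 where "(x2, y2) \<in> R" "of_int k - b < ph x2 y2" "ph x2 y2 < of_int k" "x2 + y2 < x1 + y1"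
    using ascend[OF 1(1,2) _ 1(4)] b by auto
  then show ?thesis using 1(5) c by (intro exI[of _ x2] exI[of _ y2]) (auto simp: on_path_def)
next
  case False
  then have "ph x y < of_int k" using ph_ne(1)[of x y k] by linarith
  then obtain x1 y1 j where 1: "(x1, y1) \<in> R" "of_int j + c < ph x1 y1" "ph x1 y1 < of_int j + 1 - b"
    "k \<le> j" "x1 + y1 = x + y"
    using leave_path_up[OF assms(1), of k] assms(2) by (auto simp: on_path_def)
  then obtain x2 y2 where "(x2, y2) \<in> R" "of_int k < ph x2 y2" "ph x2 y2 < of_int k + c" "x2 + y2 < x1 + y1"
    using descend[OF 1(1) _ 1(3,4)] c by auto
  then show ?thesis using 1(5) b by (intro exI[of _ x2] exI[of _ y2]) (auto simp: on_path_def)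
qed

lemma path_go_far_back:
  assumes "(x, y) \<in> R" "on_path k x y"
  shows "\<exists>x' y'. (x', y') \<in> R \<and> on_path k x' y' \<and> x' + y' \<le> x + y - int n"
proof (induction n)
  case 0 then show ?case using assms by (intro exI[of _ x] exI[of _ y]) auto
next
  case (Suc n)
  then obtain x1 y1 where "(x1, y1) \<in> R" "on_path k x1 y1" "x1 + y1 \<le> x + y - int n" by auto
  then obtain x2 y2 where "(x2, y2) \<in> R" "on_path k x2 y2" "x2 + y2 < x1 + y1"
    using path_go_back by blast
  then show ?case using \<open>x1 + y1 \<le> x + y - int n\<close> by (intro exI[of _ x2] exI[of _ y2]) auto
qed

text \<open>On a fixed antidiagonal the phase changes in multiples of \<open>b + c\<close>, which is
  the width of the open window defining a path.\<close>

lemma on_path_unique: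
  assumes "on_path k x y" "on_path k x' y'" "x + y = x' + y'"
  shows "x = x'" "y = y'"
proof -
  have y: "y = x' + y' - x" using assms(3) by simp
  have d: "ph x y - ph x' y' = (b + c) * of_int (x - x')"
    unfolding y by (simp add: ph_def algebra_simps)
  have "\<bar>ph x y - ph x' y'\<bar> < (b + c) * 1" using assms by (auto simp: on_path_def)
  then have "(b + c) * \<bar>of_int (x - x')\<bar> < (b + c) * 1" unfolding d using b c by (simp add: abs_mult)
  then have "\<bar>real_of_int (x - x')\<bar> < 1" using b c by (subst (asm) mult_less_cancel_left_pos) auto
  then show "x = x'" "y = y'" using y by auto
qed

text \<open>Walking along the path raises \<open>x + y\<close> by exactly one, so every later
  antidiagonal is visited, and \<open>on_path_unique\<close> identifies the site there.\<close>

lemma path_forward: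
  assumes "(x, y) \<in> R" "on_path k x y" "on_path k x' y'" "x + y \<le> x' + y'"
  shows "(x', y') \<in> R"
proof -
  have "\<exists>x1 y1. (x1, y1) \<in> R \<and> on_path k x1 y1 \<and> x1 + y1 = x + y + int n" for n
  proof (induction n)
    case 0 then show ?case using assms by auto
  next
    case (Suc n)
    then obtain x1 y1 where 1: "(x1, y1) \<in> R" "on_path k x1 y1" "x1 + y1 = x + y + int n" by auto
    show ?case
    proof (cases "of_int k < ph x1 y1")
      case True
      then show ?thesis using 1 step1[of x1 y1 k] b c
        by (intro exI[of _ x1] exI[of _ "y1 + 1"]) (auto simp: on_path_def)
    next
      case False
      then have "ph x1 y1 < of_int k" using ph_ne(1)[of x1 y1 k] by linarith
      then show ?thesis using 1 step2[of x1 y1 k] b c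
        by (intro exI[of _ "x1 + 1"] exI[of _ y1]) (auto simp: on_path_def)
    qed
  qed
  from this[of "nat (x' + y' - (x + y))"] obtain x1 y1 where
    "(x1, y1) \<in> R" "on_path k x1 y1" "x1 + y1 = x' + y'" using assms(4) by auto
  then show ?thesis using on_path_unique[of k x1 y1 x' y'] assms(3) by auto
qed

lemma phase_cases:
  obtains (path) k where "on_path k x y"
  | (band) k where "of_int k + c < ph x y" "ph x y < of_int k + 1 - b"
proof -
  define k where "k = \<lfloor>ph x y\<rfloor>"
  have "of_int k \<le> ph x y" "ph x y < of_int k + 1" by (auto simp: k_def)
  then show ?thesis
    using path[of k] path[of "k + 1"] band[of k] ph_ne(2)[of x y k] ph_ne(3)[of x y "k + 1"] b c
    unfolding on_path_def by (simp, linarith)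
qed

lemma R_meets_path:
  assumes "(x, y) \<in> R"
  shows "\<exists>x' y'. (x', y') \<in> R \<and> on_path k x' y'"
proof -
  obtain x1 y1 j where 1: "(x1, y1) \<in> R" "of_int j + c < ph x1 y1" "ph x1 y1 < of_int j + 1 - b"
  proof (cases rule: phase_cases[of x y])
    case (path k)
    then consider "of_int k < ph x y" | "ph x y < of_int k" using ph_ne(1)[of x y k] by linarith
    then show ?thesis
      using that leave_path_down[OF assms, of k] leave_path_up[OF assms, of k] path
      by (cases; auto simp: on_path_def)
  next
    case (band k) then show ?thesis using assms that by blast
  qed
  show ?thesis
  proof (cases "k \<le> j")
    case True
    then show ?thesis using descend[OF 1(1) _ 1(3) True] 1 b c unfolding on_path_def by fastforce
  next
    case False
    then show ?thesis using ascend[OF 1(1,2), of k] 1 b c unfolding on_path_def by fastforce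
  qed
qed

lemma path_subset:
  assumes "R \<noteq> {}" "on_path k x y" shows "(x, y) \<in> R"
proof -
  obtain x1 y1 where 1: "(x1, y1) \<in> R" "on_path k x1 y1"
    using R_meets_path[of _ _ k] assms(1) by fast
  obtain x2 y2 where "(x2, y2) \<in> R" "on_path k x2 y2" "x2 + y2 \<le> x1 + y1 - int (nat (x1 + y1 - (x + y)))"
    using path_go_far_back[OF 1] by blast
  moreover from this(3) have "x2 + y2 \<le> x + y" by (auto split: if_splits)
  ultimately show ?thesis using path_forward assms(2) by blast
qed

text \<open>A band site is reached in one move either from \<open>(x, y + 1)\<close>, if that is
  still in the band, or else from \<open>(x - 1, y + 1)\<close>, which is then on path
  \<open>k\<close>. In the first case the phase is lower by \<open>b\<close>, which drives the
  induction.\<close>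

lemma band_subset:
  assumes "R \<noteq> {}" "of_int k + c < ph x y" "ph x y < of_int k + 1 - b"
  shows "(x, y) \<in> R"
proof -
  have "\<forall>x y. of_int k + c < ph x y \<longrightarrow> ph x y < of_int k + 1 - b \<longrightarrow> ph x y < of_int k + c + real n * b
    \<longrightarrow> (x, y) \<in> R" for n
  proof (induction n)
    case (Suc n)
    show ?case
    proof (intro allI impI)
      fix x y assume A: "of_int k + c < ph x y" "ph x y < of_int k + 1 - b" "ph x y < of_int k + c + real (Suc n) * b"
      show "(x, y) \<in> R"
      proof (cases "ph x (y + 1) < of_int k + c")
        case True
        have "on_path k (x - 1) (y + 1)" using A True b c by (auto simp: on_path_def)
        then show ?thesis using path_subset[OF assms(1), of k "x - 1" "y + 1"] step2[of "x - 1" "y + 1" k] A True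
          by (auto simp: on_path_def)
      next
        case False
        with ph_ne(2)[of x "y + 1" k] have "of_int k + c < ph x (y + 1)" by linarith
        moreover from this have "(x, y + 1) \<in> R" using Suc A b by (simp add: distrib_right)
        ultimately show ?thesis using A b step3[of x "y + 1" k] by simp
      qed
    qed
  qed auto
  moreover obtain n where "ph x y - of_int k - c < real n * b" using reals_Archimedean3[OF b] by blast
  ultimately show ?thesis using assms(2,3) by (smt (verit))
qed

theorem closed_set_UNIV:
  assumes "R \<noteq> {}" shows "R = UNIV"
proof -
  have "(x, y) \<in> R" for x y
    by (cases rule: phase_cases[of x y]) (use path_subset band_subset assms in auto)
  then show ?thesis by auto
qed

end

section \<open>A corrected logarithm\<close>

text \<open>The argument is a squared modulus. Subtracting |z|^(-s) contributes -s^2 |z|^(-s-2) to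
  the Laplacian, which beats errors of order |z|^(-3) for 0 < s < 1; here s = 1/2.\<close>

definition rad :: "real \<Rightarrow> real" where "rad q = ln q - q powr (-1/4)"
definition rad1 :: "real \<Rightarrow> real" where "rad1 q = 1 / q + 1/4 * q powr (-5/4)"
definition rad2 :: "real \<Rightarrow> real" where "rad2 q = - 1 / q^2 - 5/16 * q powr (-9/4)"
definition rad3 :: "real \<Rightarrow> real" where "rad3 q = 2 / q^3 + 45/64 * q powr (-13/4)"

lemma rad_derivs:
  assumes "q > 0"
  shows "(rad has_real_derivative rad1 q) (at q)"
    and "(rad1 has_real_derivative rad2 q) (at q)"
    and "(rad2 has_real_derivative rad3 q) (at q)"
  unfolding rad_def[abs_def] rad1_def[abs_def] rad2_def[abs_def] rad3_def
  using assms
  by (auto intro!: derivative_eq_intros simp: power2_eq_square power3_eq_cube field_simps)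

text \<open>For a function of \<open>q = |z|^2\<close> the planar Laplacian is four times this
  expression. The logarithm cancels, and the power leaves the coefficient -(1/4)^2.\<close>

lemma rad_laplacian:
  assumes "q > 0"
  shows "q * rad2 q + rad1 q = - 1/16 * q powr (-5/4)"
proof -
  have "q * q powr (-9/4) = q powr (-5/4)" using assms powr_mult_base[of q "-9/4"] by simp
  then have "q * (5/16 * q powr (-9/4)) = 5/16 * q powr (-5/4)" by simp
  moreover have "q * (1 / q^2) = 1 / q" using assms by (simp add: power2_eq_square)
  ultimately show ?thesis by (simp add: rad1_def rad2_def algebra_simps)
qed

lemma rad_bounds:
  assumes "n \<ge> 1"
  shows "\<bar>rad2 (n^2)\<bar> \<le> 2 / n^4" and "\<bar>rad3 (n^2)\<bar> \<le> 3 / n^6"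
proof -
  have le: "(n^2) powr (- s) \<le> 1 / n^(2*k)" if "real k \<le> s" for s k
  proof -
    have "(n^2) powr (- s) \<le> (n^2) powr (- real k)" using assms that by (intro powr_mono) auto
    also have "\<dots> = 1 / n^(2*k)" using assms by (simp add: powr_minus powr_realpow power_mult divide_inverse)
    finally show ?thesis .
  qed
  have "(n^2) powr (-9/4) \<le> 1 / n^4" using le[of 2 "9/4"] by simp
  moreover have "0 \<le> (n^2) powr (-9/4)" by simp
  moreover have "0 \<le> 1 / n^4" "1 / (n^2)^2 = 1 / n^4" using assms by simp_all
  ultimately show "\<bar>rad2 (n^2)\<bar> \<le> 2 / n^4"
    unfolding rad2_def by linarith
  have "(n^2) powr (-13/4) \<le> 1 / n^6" using le[of 3 "13/4"] by simp
  moreover have "0 \<le> (n^2) powr (-13/4)" by simp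
  moreover have "0 \<le> 1 / n^6" "2 / (n^2)^3 = 2 * (1 / n^6)" using assms by simp_all
  ultimately show "\<bar>rad3 (n^2)\<bar> \<le> 3 / n^6"
    unfolding rad3_def by linarith
qed

context
  fixes z u :: complex and r :: real
  assumes u: "cmod u = 1" and r: "r = cmod z" "r \<ge> 2"
begin

lemma line_norm_bounds:
  assumes "\<bar>s\<bar> \<le> r / 2"
  shows "1 \<le> cmod (z + of_real s * u)" and "r / 2 \<le> cmod (z + of_real s * u)"
proof -
  have "r \<le> cmod (z + of_real s * u) + cmod (of_real s * u)"
    using norm_triangle_ineq4[of "z + of_real s * u" "of_real s * u"] by (simp add: r)
  also have "cmod (of_real s * u) \<le> r / 2" using assms u by (simp add: norm_mult)
  finally show "r / 2 \<le> cmod (z + of_real s * u)" by simp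
  then show "1 \<le> cmod (z + of_real s * u)" using r by simp
qed

lemma line_norm_deriv:
  "((\<lambda>s. (cmod (z + of_real s * u))^2) has_real_derivative 2 * Re (cnj (z + of_real s * u) * u)) (at s)"
proof -
  have eq: "(\<lambda>s. (cmod (z + of_real s * u))^2) = (\<lambda>s. (Re z + s * Re u)^2 + (Im z + s * Im u)^2)"
    by (simp add: cmod_power2)
  show ?thesis unfolding eq
    by (auto intro!: derivative_eq_intros simp: algebra_simps)
qed

lemma line_norm_deriv2:
  "((\<lambda>s. 2 * Re (cnj (z + of_real s * u) * u)) has_real_derivative 2) (at s)"
proof -
  have "(Re u)^2 + (Im u)^2 = 1" using u cmod_power2[of u] by simp
  then show ?thesis
    by (auto intro!: derivative_eq_intros simp: algebra_simps power2_eq_square)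
qed

lemma line_norm_deriv_bound:
  "\<bar>2 * Re (cnj (z + of_real s * u) * u)\<bar> \<le> 2 * cmod (z + of_real s * u)"
  using abs_Re_le_cmod[of "cnj (z + of_real s * u) * u"] u
  unfolding norm_mult complex_mod_cnj by simp

lemma cube_inverse_bound:
  assumes "r / 2 \<le> n" shows "1 / n^3 \<le> 8 / r^3"
proof -
  have "0 < n" "0 < r" using assms r(2) by linarith+
  then have "1 / n^3 \<le> 1 / (r/2)^3" using assms by (intro divide_left_mono power_mono) auto
  then show ?thesis by (simp add: power_divide)
qed

text \<open>The squared norm is quadratic in the parameter, so the third derivative of the composite
  is \<open>rad3 * q'^3 + 6 * rad2 * q'\<close>. At modulus n \<ge> r/2 it is at most 48/n^3 \<le>
  384/r^3; division by \<open>fact 3\<close> gives 64.\<close>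

lemma rad_line_taylor:
  assumes t: "\<bar>t\<bar> \<le> r / 2"
  shows "\<bar>rad ((cmod (z + of_real t * u))^2) - rad (r^2) - rad1 (r^2) * (2 * Re (cnj z * u)) * t
    - (4 * rad2 (r^2) * (Re (cnj z * u))^2 + 2 * rad1 (r^2)) / 2 * t^2\<bar> \<le> 64 / r^3 * \<bar>t\<bar>^3"
proof -
  define q where "q s = (cmod (z + of_real s * u))^2" for s
  define q' where "q' s = 2 * Re (cnj (z + of_real s * u) * u)" for s
  have dq: "(q has_real_derivative q' s) (at s)" "(q' has_real_derivative 2) (at s)" for s
    unfolding q_def[abs_def] q'_def[abs_def] by (rule line_norm_deriv line_norm_deriv2)+
  define D where "D m = (if m = 0 then \<lambda>s. rad (q s) else if m = 1 then \<lambda>s. rad1 (q s) * q' s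
    else if m = 2 then \<lambda>s. rad2 (q s) * (q' s)^2 + 2 * rad1 (q s)
    else (\<lambda>s. rad3 (q s) * (q' s)^3 + 6 * rad2 (q s) * q' s))" for m :: nat
  have dD: "(D m has_real_derivative D (Suc m) s) (at s)" if "m < 3" "\<bar>s\<bar> \<le> \<bar>t\<bar>" for m s
  proof -
    have "q s > 0" using line_norm_bounds(1)[of s] that t unfolding q_def
      by (intro zero_less_power) linarith
    then have d: "((\<lambda>s. rad (q s)) has_real_derivative rad1 (q s) * q' s) (at s)"
      "((\<lambda>s. rad1 (q s)) has_real_derivative rad2 (q s) * q' s) (at s)"
      "((\<lambda>s. rad2 (q s)) has_real_derivative rad3 (q s) * q' s) (at s)"
      by (auto intro!: DERIV_chain2[OF _ dq(1)] rad_derivs)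
    from \<open>m < 3\<close> consider "m = 0" | "m = 1" | "m = 2" by linarith
    then show ?thesis
    proof cases
      case 1 then show ?thesis using d(1) by (simp add: D_def)
    next
      case 2
      then show ?thesis
        by (auto simp: D_def power2_eq_square intro!: derivative_eq_intros d(2) dq(2))
    next
      case 3
      then show ?thesis
        by (auto simp: D_def power2_eq_square power3_eq_cube algebra_simps intro!: derivative_eq_intros d dq(2))
    qed
  qed
  obtain s where s: "\<bar>s\<bar> \<le> \<bar>t\<bar>" "rad (q t) = (\<Sum>m<3. D m 0 / fact m * t^m) + D 3 s / fact 3 * t^3"
    using Maclaurin_bi_le[of D "\<lambda>s. rad (q s)" 3 t] dD by (auto simp: D_def)
  define n where "n = cmod (z + of_real s * u)"
  have n: "n \<ge> 1" "r / 2 \<le> n" using line_norm_bounds[of s] s(1) t by (auto simp: n_def)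
  have q'n: "\<bar>q' s\<bar> \<le> 2 * n" unfolding q'_def n_def by (rule line_norm_deriv_bound)
  have "D 3 s = rad3 (n^2) * q' s^3 + 6 * rad2 (n^2) * q' s" by (simp add: D_def q_def n_def)
  also have "\<bar>\<dots>\<bar> \<le> \<bar>rad3 (n^2) * q' s^3\<bar> + \<bar>6 * rad2 (n^2) * q' s\<bar>" by (rule abs_triangle_ineq)
  also have "\<dots> = \<bar>rad3 (n^2)\<bar> * \<bar>q' s\<bar>^3 + 6 * \<bar>rad2 (n^2)\<bar> * \<bar>q' s\<bar>"
    unfolding abs_mult power_abs by simp
  also have "\<dots> \<le> 3 / n^6 * (2 * n)^3 + 6 * (2 / n^4) * (2 * n)"
    using rad_bounds[OF n(1)] q'n n by (intro add_mono mult_mono power_mono) auto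
  also have "\<dots> = 48 * (1 / n^3)" using n by (simp add: field_simps eval_nat_numeral)
  also have "\<dots> \<le> 48 * (8 / r^3)" using cube_inverse_bound[OF n(2)] by (intro mult_left_mono) auto
  finally have D3: "\<bar>D 3 s\<bar> \<le> 384 / r^3" by simp
  have sum: "(\<Sum>m<3. D m 0 / fact m * t^m) = rad (r^2) + rad1 (r^2) * (2 * Re (cnj z * u)) * t
    + (4 * rad2 (r^2) * (Re (cnj z * u))^2 + 2 * rad1 (r^2)) / 2 * t^2"
    by (simp add: eval_nat_numeral D_def q_def q'_def r) (simp add: algebra_simps)
  have "rad (q t) - rad (r^2) - rad1 (r^2) * (2 * Re (cnj z * u)) * t
    - (4 * rad2 (r^2) * (Re (cnj z * u))^2 + 2 * rad1 (r^2)) / 2 * t^2 = D 3 s / 6 * t^3"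
    using s(2) unfolding sum by (simp add: fact_numeral)
  moreover have "\<bar>D 3 s / 6 * t^3\<bar> \<le> 64 / r^3 * \<bar>t\<bar>^3"
    unfolding abs_mult power_abs using D3 by (intro mult_right_mono) auto
  ultimately show ?thesis unfolding q_def by metis
qed

text \<open>The coefficient of the corrector has a derivative of order |z|^(-3), so it may be frozen
  at \<open>z\<close> during one jump. The derivative is at most 10/n^3 at modulus n \<ge> r/2,
  hence 80.\<close>

lemma rad2_line_lipschitz:
  assumes t: "\<bar>t\<bar> \<le> r / 2"
  shows "cmod (of_real (rad2 ((cmod (z + of_real t * u))^2)) * cnj (z + of_real t * u)^2
      - of_real (rad2 (r^2)) * cnj z^2) \<le> 80 / r^3 * \<bar>t\<bar>"
proof -
  define q where "q s = (cmod (z + of_real s * u))^2" for s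
  define q' where "q' s = 2 * Re (cnj (z + of_real s * u) * u)" for s
  define k where "k s = of_real (rad2 (q s)) * cnj (z + of_real s * u)^2" for s
  define k' where "k' s = of_real (rad3 (q s) * q' s) * cnj (z + of_real s * u)^2
     + of_real (rad2 (q s)) * (2 * cnj (z + of_real s * u) * cnj u)" for s
  have dk: "(k has_vector_derivative k' s) (at s)" if "\<bar>s\<bar> \<le> \<bar>t\<bar>" for s
  proof -
    have "q s > 0" using line_norm_bounds(1)[of s] that t unfolding q_def
      by (intro zero_less_power) linarith
    then have "((\<lambda>s. rad2 (q s)) has_real_derivative rad3 (q s) * q' s) (at s)"
      using DERIV_chain2[OF rad_derivs(3) line_norm_deriv[of s]] by (simp add: q_def[abs_def] q'_def)
    then have 1: "((\<lambda>s. complex_of_real (rad2 (q s))) has_vector_derivative of_real (rad3 (q s) * q' s)) (at s)"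
      by (intro has_vector_derivative_of_real) (simp add: has_real_derivative_iff_has_vector_derivative)
    have 2: "((\<lambda>s. cnj z + of_real s * cnj u) has_vector_derivative cnj u) (at s)"
      by (auto intro!: derivative_eq_intros)
    show ?thesis unfolding k_def[abs_def] k'_def power2_eq_square complex_cnj_add complex_cnj_mult complex_cnj_complex_of_real
      by (rule has_vector_derivative_eq_rhs[OF has_vector_derivative_mult[OF 1 has_vector_derivative_mult[OF 2 2]]])
        (simp add: algebra_simps)
  qed
  have bk: "cmod (k' s) \<le> 80 / r^3" if "\<bar>s\<bar> \<le> \<bar>t\<bar>" for s
  proof -
    define n where "n = cmod (z + of_real s * u)"
    have n: "n \<ge> 1" "r / 2 \<le> n" using line_norm_bounds[of s] that t by (auto simp: n_def)
    have q'n: "\<bar>q' s\<bar> \<le> 2 * n" unfolding q'_def n_def by (rule line_norm_deriv_bound)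
    have "cmod (k' s) \<le> \<bar>rad3 (n^2)\<bar> * \<bar>q' s\<bar> * n^2 + \<bar>rad2 (n^2)\<bar> * (2 * n)"
      unfolding k'_def q_def n_def
      by (rule order_trans[OF norm_triangle_ineq]) (simp add: norm_mult norm_power abs_mult u flip: complex_cnj_add complex_cnj_mult)
    also have "\<dots> \<le> 3 / n^6 * (2 * n) * n^2 + 2 / n^4 * (2 * n)"
      using rad_bounds[OF n(1)] q'n n by (intro add_mono mult_mono) auto
    also have "\<dots> = 10 * (1 / n^3)" using n by (simp add: field_simps eval_nat_numeral)
    also have "\<dots> \<le> 10 * (8 / r^3)" using cube_inverse_bound[OF n(2)] by (intro mult_left_mono) auto
    finally show ?thesis by simp
  qed
  have "norm (k t - k 0) \<le> 80 / r^3 * norm (t - 0)"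
  proof (rule differentiable_bound[where S = "{- \<bar>t\<bar>..\<bar>t\<bar>}" and f' = "\<lambda>s h. h *\<^sub>R k' s"])
    show "(k has_derivative (\<lambda>h. h *\<^sub>R k' s)) (at s within {- \<bar>t\<bar>..\<bar>t\<bar>})" if "s \<in> {- \<bar>t\<bar>..\<bar>t\<bar>}" for s
      using dk[of s] that by (auto simp: has_vector_derivative_def intro: has_derivative_at_withinI)
    show "onorm (\<lambda>h. h *\<^sub>R k' s) \<le> 80 / r^3" if "s \<in> {- \<bar>t\<bar>..\<bar>t\<bar>}" for s
    proof (rule onorm_bound)
      show "0 \<le> 80 / r^3" using r(2) by simp
      have "cmod (k' s) \<le> 80 / r^3" using bk[of s] that by auto
      then show "norm (h *\<^sub>R k' s) \<le> 80 / r^3 * norm h" for h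
        using mult_left_mono[of "cmod (k' s)" "80 / r^3" "\<bar>h\<bar>"] by (simp add: mult.commute)
    qed
  qed auto
  then show ?thesis by (simp add: k_def q_def r)
qed

end

lemma Re_complex_of_real_mult: "Re (of_real a * w) = a * Re w"
  by simp

text \<open>Along a direction \<open>u\<close> the second derivative of \<open>rad (|z|^2)\<close> is half the Laplacian, of order
  \<open>- |z|^(-5/2)\<close>, plus an oscillating term \<open>2 * rad2 (|z|^2) * Re (cnj z^2 * u^2)\<close> of larger order.
  A bounded \<open>\<xi>\<close> whose image under the generator is \<open>u^2\<close> times the segment length cancels the latter
  up to \<open>O(|z|^(-3))\<close>.\<close>

definition lyap :: "complex \<Rightarrow> complex \<Rightarrow> real" where
  "lyap z \<xi> = rad ((cmod z)^2) - Re (\<xi> * (of_real (rad2 ((cmod z)^2)) * cnj z^2))"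

text \<open>First-order terms cancel and \<open>corr\<close> removes the oscillating second-order
  term. What remains is \<open>s + t\<close> times a drift of -1/16 |z|^(-5/2), against errors of
  order |z|^(-3); the bound on \<open>sqrt (cmod z)\<close> is this comparison. The corrector error
  carries no factor \<open>s + t\<close>, which is why \<open>l\<close> enters.\<close>

lemma lyap_superharmonic_far:
  assumes "cmod u = 1" "0 < s" "s \<le> L" "0 < t" "t \<le> L" "0 < l" "l \<le> s + t"
    and X: "cmod \<xi>1 \<le> X" "cmod \<xi>2 \<le> X"
    and corr: "(\<xi>1 - \<xi>0) / of_real s + (\<xi>2 - \<xi>0) / of_real t = of_real (s + t) * u^2"
    and r: "cmod z \<ge> 2" "cmod z \<ge> 2 * L" "sqrt (cmod z) \<ge> 16 * (64 * L + 160 * X / l)"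
  shows "(lyap (z + of_real s * u) \<xi>1 - lyap z \<xi>0) / s + (lyap (z - of_real t * u) \<xi>2 - lyap z \<xi>0) / t \<le> 0"
proof -
  define r where "r = cmod z"
  have r2: "r \<ge> 2" and u: "cmod u = 1" using assms by (auto simp: r_def)
  have sb: "\<bar>s\<bar> \<le> r / 2" "\<bar>- t\<bar> \<le> r / 2" using assms by (auto simp: r_def)
  define g where "g t = rad ((cmod (z + of_real t * u))^2)" for t
  define g0 where "g0 = rad (r^2)"
  define d where "d = rad1 (r^2) * (2 * Re (cnj z * u))"
  define e where "e = (4 * rad2 (r^2) * (Re (cnj z * u))^2 + 2 * rad1 (r^2)) / 2"
  define k where "k t = of_real (rad2 ((cmod (z + of_real t * u))^2)) * cnj (z + of_real t * u)^2" for t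
  define k0 where "k0 = complex_of_real (rad2 (r^2)) * cnj z^2"
  note ty = rad_line_taylor[OF u r_def r2, folded g_def g0_def d_def e_def]
  note li = rad2_line_lipschitz[OF u r_def r2, folded k_def k0_def]
  have pos: "r > 0" "r^3 > 0" using r2 by auto
  have gs: "(g s - g0) / s \<le> d + e * s + 64 / r^3 * s^2"
  proof -
    have "g s - g0 \<le> (d + e * s + 64 / r^3 * s^2) * s"
      using ty[OF sb(1)] assms(2) by (simp add: abs_le_iff algebra_simps power2_eq_square power3_eq_cube)
    then show ?thesis using assms(2) by (simp add: pos_divide_le_eq)
  qed
  have gt: "(g (- t) - g0) / t \<le> - d + e * t + 64 / r^3 * t^2"
  proof -
    have "g (- t) - g0 \<le> (- d + e * t + 64 / r^3 * t^2) * t"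
      using ty[OF sb(2)] assms(4) by (simp add: abs_le_iff algebra_simps power2_eq_square power3_eq_cube)
    then show ?thesis using assms(4) by (simp add: pos_divide_le_eq)
  qed
  have sq: "s^2 + t^2 \<le> L * (s + t)"
    unfolding power2_eq_square distrib_left using assms(2-5) by (intro add_mono mult_right_mono) auto
  have "64 / r^3 * (s^2 + t^2) \<le> 64 / r^3 * (L * (s + t))" using sq pos by (intro mult_left_mono) auto
  moreover have "(s + t) * (e + 64 * L / r^3) = e * s + e * t + 64 / r^3 * (L * (s + t))"
    by (simp add: algebra_simps)
  ultimately have g: "(g s - g0) / s + (g (- t) - g0) / t \<le> (s + t) * (e + 64 * L / r^3)"
    using gs gt unfolding distrib_left[of "64 / r^3" "s^2"] by linarith
  \<comment> \<open>Splits the second derivative into an isotropic part, which joins the Laplacian,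
    and an oscillating part.\<close>
  have "(Re (cnj z * u))^2 = (r^2 + Re (cnj z^2 * u^2)) / 2"
  proof -
    have "(cmod (cnj z * u))^2 = r^2" using u by (simp add: norm_mult r_def)
    moreover have "2 * (Re w)^2 = (cmod w)^2 + Re (w^2)" for w
      unfolding cmod_power2 by (simp add: power2_eq_square)
    ultimately have "2 * (Re (cnj z * u))^2 = r^2 + Re (cnj z^2 * u^2)"
      by (metis (no_types) power_mult_distrib)
    then show ?thesis by (metis nonzero_mult_div_cancel_left zero_neq_numeral)
  qed
  then have e: "e = - 1/16 * (r^2) powr (-5/4) + Re (k0 * u^2)"
  proof -
    assume eq: "(Re (cnj z * u))^2 = (r^2 + Re (cnj z^2 * u^2)) / 2"
    have "e = (r^2 * rad2 (r^2) + rad1 (r^2)) + rad2 (r^2) * Re (cnj z^2 * u^2)"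
      unfolding e_def eq by (simp add: field_simps)
    also have "rad2 (r^2) * Re (cnj z^2 * u^2) = Re (k0 * u^2)"
      unfolding k0_def mult.assoc by (rule Re_complex_of_real_mult[symmetric])
    finally show ?thesis using rad_laplacian[of "r^2"] pos by simp
  qed
  have corr_err: "- Re ((\<xi>1 * k s - \<xi>0 * k0) / of_real s + (\<xi>2 * k (- t) - \<xi>0 * k0) / of_real t)
    \<le> - (s + t) * Re (k0 * u^2) + 160 * X / r^3"
  proof -
    have e1: "cmod (\<xi>1 * (k s - k0) / of_real s) \<le> X * (80 / r^3)"
    proof -
      have "cmod (\<xi>1 * (k s - k0)) \<le> X * (80 / r^3 * s)"
        unfolding norm_mult using li[OF sb(1)] assms(2) X order_trans[OF norm_ge_zero X(1)] by (intro mult_mono) auto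
      then show ?thesis using assms(2) by (simp add: norm_divide pos_divide_le_eq mult.assoc)
    qed
    have e2: "cmod (\<xi>2 * (k (- t) - k0) / of_real t) \<le> X * (80 / r^3)"
    proof -
      have "cmod (\<xi>2 * (k (- t) - k0)) \<le> X * (80 / r^3 * t)"
        unfolding norm_mult using li[OF sb(2)] assms(4) X order_trans[OF norm_ge_zero X(1)] by (intro mult_mono) auto
      then show ?thesis using assms(4) by (simp add: norm_divide pos_divide_le_eq mult.assoc)
    qed
    have "(\<xi>1 * k s - \<xi>0 * k0) / of_real s + (\<xi>2 * k (- t) - \<xi>0 * k0) / of_real t
      = ((\<xi>1 - \<xi>0) / of_real s + (\<xi>2 - \<xi>0) / of_real t) * k0
        + (\<xi>1 * (k s - k0) / of_real s + \<xi>2 * (k (- t) - k0) / of_real t)"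
      by (simp add: algebra_simps add_divide_distrib diff_divide_distrib)
    also have "\<dots> = of_real (s + t) * (k0 * u^2)
        + (\<xi>1 * (k s - k0) / of_real s + \<xi>2 * (k (- t) - k0) / of_real t)"
      unfolding corr by (simp add: algebra_simps)
    finally have eq: "(\<xi>1 * k s - \<xi>0 * k0) / of_real s + (\<xi>2 * k (- t) - \<xi>0 * k0) / of_real t
      = of_real (s + t) * (k0 * u^2)
        + (\<xi>1 * (k s - k0) / of_real s + \<xi>2 * (k (- t) - k0) / of_real t)" .
    have neg: "- Re w \<le> cmod w" for w using abs_Re_le_cmod[of w] by linarith
    have "- Re (\<xi>1 * (k s - k0) / of_real s) \<le> X * (80 / r^3)"
      "- Re (\<xi>2 * (k (- t) - k0) / of_real t) \<le> X * (80 / r^3)"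
      using order_trans[OF neg e1] order_trans[OF neg e2] by blast+
    moreover have "160 * X / r^3 = X * (80 / r^3) + X * (80 / r^3)" by simp
    ultimately show ?thesis
      unfolding eq plus_complex.sel Re_complex_of_real_mult by (simp only: minus_add_distrib minus_mult_left) 
  qed
  have main: "160 * X / l + 64 * L \<le> 1/16 * (r^2) powr (-5/4) * r^3"
  proof -
    have "(r^2) powr (-5/4) = r powr (-5/2)" using pos by (simp add: powr_powr flip: powr_numeral)
    then have "(r^2) powr (-5/4) * r^3 = r powr (-5/2) * r powr 3" using pos by (simp add: powr_numeral)
    also have "\<dots> = r powr (1/2)" by (subst powr_add[symmetric]) simp
    also have "\<dots> = sqrt r" using pos by (simp add: powr_half_sqrt)
    finally show ?thesis using r(3) by (simp add: r_def)
  qed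
  have "(lyap (z + of_real s * u) \<xi>1 - lyap z \<xi>0) / s + (lyap (z - of_real t * u) \<xi>2 - lyap z \<xi>0) / t
     = ((g s - g0) / s + (g (- t) - g0) / t)
      - Re ((\<xi>1 * k s - \<xi>0 * k0) / of_real s + (\<xi>2 * k (- t) - \<xi>0 * k0) / of_real t)"
    unfolding lyap_def g_def g0_def k_def k0_def r_def by (simp add: diff_divide_distrib)
  also have "\<dots> \<le> (s + t) * (e + 64 * L / r^3) - (s + t) * Re (k0 * u^2) + 160 * X / r^3"
    using g corr_err by linarith
  also have "\<dots> = (s + t) * (64 * L / r^3 - 1/16 * (r^2) powr (-5/4)) + 160 * X / r^3"
    by (simp add: e algebra_simps)
  also have "\<dots> \<le> (s + t) * (- (160 * X / l) / r^3) + 160 * X / r^3"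
  proof -
    have "64 * L / r^3 - 1/16 * (r^2) powr (-5/4) \<le> - (160 * X / l) / r^3"
      using main pos by (simp add: field_simps)
    then show ?thesis using assms by (intro add_right_mono mult_left_mono) auto
  qed
  also have "\<dots> = 160 * X / r^3 * (1 - (s + t) / l)" using assms(6) pos by (simp add: field_simps)
  also have "\<dots> \<le> 0"
  proof -
    have "X \<ge> 0" using order_trans[OF norm_ge_zero X(1)] .
    moreover have "(s + t) / l \<ge> 1" using assms by simp
    ultimately show ?thesis using pos by (intro mult_nonneg_nonpos) auto
  qed
  finally show ?thesis .
qed

text \<open>Source of properness: the power is at most 1, and the decay of \<open>rad2\<close> keeps
  the corrector term below \<open>2 * X\<close>.\<close>

lemma lyap_ge_ln:
  assumes "cmod z \<ge> 1" "cmod \<xi> \<le> X"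
  shows "ln ((cmod z)^2) - 1 - 2 * X \<le> lyap z \<xi>"
proof -
  define n where "n = cmod z"
  have n: "n \<ge> 1" using assms by (simp add: n_def)
  have "(n^2) powr (-1/4) \<le> (n^2) powr 0" using n by (intro powr_mono) auto
  then have 1: "ln (n^2) - 1 \<le> rad (n^2)" using n by (simp add: rad_def)
  have "Re (\<xi> * (of_real (rad2 (n^2)) * cnj z^2)) \<le> cmod (\<xi> * (of_real (rad2 (n^2)) * cnj z^2))"
    by (rule complex_Re_le_cmod)
  also have "\<dots> = cmod \<xi> * (\<bar>rad2 (n^2)\<bar> * n^2)" by (simp add: norm_mult norm_power n_def)
  also have "\<dots> \<le> X * (2 / n^4 * n^2)"
    using assms rad_bounds(1)[OF n] order_trans[OF norm_ge_zero assms(2)] n by (intro mult_mono) auto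
  also have "2 / n^4 * n^2 = 2 / n^2" using n by (simp add: field_simps eval_nat_numeral)
  also have "X * (2 / n^2) \<le> X * 2"
    using n order_trans[OF norm_ge_zero assms(2)] by (intro mult_left_mono) (auto simp: divide_le_eq)
  finally show ?thesis using 1 by (simp add: lyap_def n_def)
qed

section \<open>T-graphs\<close>

lemma int_sum_telescope:
  fixes g :: "int \<Rightarrow> complex"
  shows "(\<Sum>k\<in>{0..<x}. g (k + 1) - g k) - (\<Sum>k\<in>{x..<0}. g (k + 1) - g k) = g x - g 0"
proof (induction x rule: int_induct[where k = 0])
  case base then show ?case by simp
next
  case (step1 i)
  have "{0..<i + 1} = insert i {0..<i}" "{i..<0} = {}" "{i + 1..<0} = {}" using step1 by auto
  then show ?case using step1 by simp
next
  case (step2 i)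
  have "{i - 1..<0} = insert (i - 1) {i..<0}" "{0..<i} = {}" "{0..<i - 1} = {}" using step2 by auto
  then show ?case using step2 by simp
qed

lemma sin_pi_shift: "sin (pi * (of_int k + r)) = cos (pi * of_int k) * sin (pi * r)"
  by (simp add: distrib_left sin_add)

lemma cos_pi_int_sq: "cos (pi * of_int k) * cos (pi * of_int k) = (1 :: real)"
  by simp

lemma opposite_sign_abs:
  fixes s t :: real
  assumes "s * t < 0"
  shows "\<bar>s\<bar> \<le> \<bar>s - t\<bar>" "\<bar>t\<bar> \<le> \<bar>s - t\<bar>"
  using assms by (auto simp: mult_less_0_iff)

locale tgraph =
  fixes pa pb pc :: real and lam :: complex
  assumes pos: "0 < pa" "0 < pb" "0 < pc" and sum1: "pa + pb + pc = 1" and lam: "cmod lam = 1"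
begin

section \<open>The triangle Delta and the two rotation factors\<close>

abbreviation "B \<equiv> tB pa pb pc"
abbreviation "\<mu> \<equiv> tmu pa pb pc"
abbreviation "\<nu> \<equiv> tnu pa pb pc"
abbreviation "scl \<equiv> tscale pa pb pc lam"
abbreviation "fac \<equiv> tfac pa pb pc lam"
abbreviation "psi \<equiv> tpsi pa pb pc lam"

text \<open>By the law of sines, \<open>\<alpha>\<close> and \<open>\<beta>\<close> are the side
  lengths \<open>cmod (B - 1)\<close> and \<open>cmod B\<close> of Delta, whose third side is
  1.\<close>

definition \<alpha> :: real where "\<alpha> = sin (pi * pa) / sin (pi * pc)"
definition \<beta> :: real where "\<beta> = sin (pi * pb) / sin (pi * pc)"

lemma less1: "pa < 1" "pb < 1" "pc < 1"
  using pos sum1 by auto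

lemma sin_pos: "0 < sin (pi * pa)" "0 < sin (pi * pb)" "0 < sin (pi * pc)"
  using pos less1 by (auto intro!: sin_gt_zero)

lemma \<alpha>_pos: "0 < \<alpha>" and \<beta>_pos: "0 < \<beta>"
  using sin_pos by (auto simp: \<alpha>_def \<beta>_def)

lemma pi_pc: "pi * pc = pi - (pi * pa + pi * pb)"
proof -
  have eq: "pc = 1 - (pa + pb)" using sum1 by simp
  show ?thesis unfolding eq by (simp add: algebra_simps)
qed

lemma B_minus_1: "B - 1 = of_real \<alpha> * \<nu>"
proof -
  have "sin (pi * pc) = sin (pi * pa + pi * pb)" unfolding pi_pc by simp
  then have eq: "cis (pi * pa) * of_real (sin (pi * pb)) - of_real (sin (pi * pc))
    = - of_real (sin (pi * pa)) * cis (- (pi * pb))"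
    by (auto simp: complex_eq_iff sin_add)
  have "B - 1 = (cis (pi * pa) * of_real (sin (pi * pb)) - of_real (sin (pi * pc))) / of_real (sin (pi * pc))"
    using sin_pos(3) by (simp add: tB_def diff_divide_distrib)
  then show ?thesis unfolding eq by (simp add: tnu_def \<alpha>_def)
qed

lemma unit_mu_nu [simp]: "cmod \<mu> = 1" "cmod \<nu> = 1" "\<mu> \<noteq> 0" "\<nu> \<noteq> 0"
  by (auto simp: tmu_def tnu_def)

lemma cmod_B: "cmod B = \<beta>"
  using \<beta>_pos by (simp add: tB_def norm_mult \<beta>_def[symmetric])

lemma B_mu: "B * \<mu> = of_real \<beta> * \<nu>"
proof -
  have eq: "cis (pi * pa) * cis (pi * pc) = - cis (- (pi * pb))"
    unfolding pi_pc by (simp add: cis_mult complex_eq_iff)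
  have "B * \<mu> = of_real \<beta> * (cis (pi * pa) * cis (pi * pc))" by (simp add: tB_def tmu_def \<beta>_def)
  then show ?thesis unfolding eq by (simp add: tnu_def)
qed

lemma B_nonzero: "B \<noteq> 0"
  using cmod_B \<beta>_pos by auto

text \<open>The rotations built into \<open>tfac\<close> are the same numbers \<open>\<nu>\<close>
  and, in \<open>tzeta_eq\<close>, \<open>\<mu>\<close> that drive the real scale; hence
  \<open>fac\<close> is \<open>Re (lam * W x y)\<close> times the same \<open>W x y\<close>.\<close>

lemma teta_eq: "teta pa pb pc = \<nu>"
  using \<alpha>_pos by (simp add: teta_def B_minus_1 norm_mult)

lemma tzeta_eq: "tzeta pa pb pc = \<mu>"
proof -
  have "tzeta pa pb pc = \<nu> * of_real \<beta> / B"
    using \<alpha>_pos by (simp add: tzeta_def B_minus_1 norm_mult cmod_B)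
  also have "\<dots> = \<mu>" using B_mu B_nonzero by (simp add: field_simps)
  finally show ?thesis .
qed

lemma nu_eq: "\<nu> = of_real \<beta> * \<mu> - of_real \<alpha>"
proof -
  have "sin (pi * pb) * cos (pi * pc) + sin (pi * pc) * cos (pi * pb) = sin (pi * pa)"
  proof -
    have "pi * pa = pi - (pi * pb + pi * pc)" using pi_pc by simp
    then have "sin (pi * pa) = sin (pi * pb + pi * pc)" by simp
    then show ?thesis by (simp add: sin_add)
  qed
  then have eq: "of_real (sin (pi * pb)) * cis (pi * pc) - of_real (sin (pi * pa))
    = - of_real (sin (pi * pc)) * cis (- (pi * pb))"
    by (auto simp: complex_eq_iff)
  have "of_real \<beta> * \<mu> - of_real \<alpha> = (of_real (sin (pi * pb)) * cis (pi * pc) - of_real (sin (pi * pa))) / of_real (sin (pi * pc))"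
    by (simp add: tmu_def \<alpha>_def \<beta>_def diff_divide_distrib)
  then show ?thesis unfolding eq using sin_pos(3) by (simp add: tnu_def)
qed

definition W :: "int \<Rightarrow> int \<Rightarrow> complex" where "W x y = \<mu> powi x * \<nu> powi y"

lemma W_shift: "W (x + 1) y = W x y * \<mu>" "W x (y + 1) = W x y * \<nu>"
  by (simp_all add: W_def power_int_add_1)

lemma cmod_W [simp]: "cmod (W x y) = 1"
  by (simp add: W_def norm_mult norm_power_int)

lemma scl_eq: "scl x y = Re (lam * W x y)"
  by (simp add: tscale_def W_def mult.assoc)

lemma fac_eq: "fac x y = of_real (scl x y) * W x y"
  by (simp add: tfac_def tzeta_eq teta_eq W_def mult.assoc)

text \<open>Closing condition of a black face: its three edges are parallel and their signed lengths
  add up.\<close>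

lemma scl_rel: "scl x (y + 1) = \<beta> * scl (x + 1) y - \<alpha> * scl x y"
proof -
  have "lam * (W x y * \<nu>) = of_real \<beta> * (lam * (W x y * \<mu>)) - of_real \<alpha> * (lam * W x y)"
    by (subst nu_eq) (simp add: algebra_simps)
  then show ?thesis unfolding scl_eq W_shift by (metis Re_complex_of_real_mult minus_complex.sel(1))
qed

lemma abs_scl_le: "\<bar>scl x y\<bar> \<le> 1"
  using abs_Re_le_cmod[of "lam * W x y"] lam unfolding scl_eq norm_mult by simp

lemma mu_sq_ne: "\<mu>^2 \<noteq> 1"
proof
  assume "\<mu>^2 = 1"
  then have "\<mu> = 1 \<or> \<mu> = -1" by (simp add: power2_eq_1_iff)
  then have "Im \<mu> = 0" by auto
  then show False using sin_pos(3) by (simp add: tmu_def)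
qed

text \<open>Compatibility of the horizontal increments \<open>osc\<close> with the vertical ones
  \<open>B * osc\<close>: both are differences of the single bounded function
  \<open>om\<close>.\<close>

lemma nu_sq: "\<nu>^2 - 1 = B * (\<mu>^2 - 1)"
proof -
  have "B * \<mu>^2 = of_real \<beta> * \<nu> * \<mu>" using B_mu by (simp add: power2_eq_square mult.assoc[symmetric])
  also have "\<dots> = \<nu> * (\<nu> + of_real \<alpha>)" using nu_eq by (simp add: algebra_simps)
  finally show ?thesis using B_minus_1 by (simp add: algebra_simps power2_eq_square)
qed

section \<open>Explicit form of the lattice map\<close>

definition C :: complex where "C = 1 / (\<mu>^2 - 1)"

definition om :: "int \<Rightarrow> int \<Rightarrow> complex" where "om x y = lam / 2 * C * W x y ^ 2"

definition osc :: "int \<Rightarrow> int \<Rightarrow> complex" where "osc x y = lam / 2 * W x y ^ 2"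

definition Z :: "int \<Rightarrow> int \<Rightarrow> complex" where "Z x y = of_int x + B * of_int y"

lemma Z_shift: "Z (x + 1) y = Z x y + 1" "Z x (y + 1) = Z x y + B"
  by (simp_all add: Z_def algebra_simps)

text \<open>Since \<open>Re w * w\<close> has a constant and a second-harmonic part, the map \<open>psi\<close> is up to a
  translation the linear embedding plus a bounded oscillation.\<close>

definition pos_of :: "int \<times> int \<Rightarrow> complex" where
  "pos_of = (\<lambda>(x, y). cnj lam / 2 * Z x y + om x y)"

lemma om_C: "om x y = C * osc x y"
  by (simp add: om_def osc_def)

lemma C_mu: "C * (\<mu>^2 - 1) = 1" "C * \<mu>^2 = C + 1"
  using mu_sq_ne by (simp_all add: C_def field_simps)

lemma om_shift: "om (x + 1) y = om x y + osc x y" "om x (y + 1) = om x y + B * osc x y"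
proof -
  have "om (x + 1) y = osc x y * (C * \<mu>^2)" by (simp add: om_def osc_def W_shift power_mult_distrib)
  then show "om (x + 1) y = om x y + osc x y" by (simp add: C_mu om_C algebra_simps)
  have "om x (y + 1) = osc x y * (C * \<nu>^2)" by (simp add: om_def osc_def W_shift power_mult_distrib)
  also have "C * \<nu>^2 = C + C * (\<nu>^2 - 1)" by (simp add: algebra_simps)
  also have "\<dots> = C + B * (C * (\<mu>^2 - 1))" unfolding nu_sq by simp
  finally show "om x (y + 1) = om x y + B * osc x y" by (simp add: C_mu om_C algebra_simps)
qed

lemma fac_osc: "fac x y = cnj lam / 2 + osc x y"
proof -
  have w: "cnj (W x y) * W x y = 1" by (metis cmod_W complex_norm_square mult.commute of_real_1 power_one)
  have eq: "complex_of_real (scl x y) = (lam * W x y + cnj (lam * W x y)) / 2"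
    unfolding scl_eq by (simp add: complex_eq_iff)
  have "fac x y = (lam * W x y * W x y + cnj lam * (cnj (W x y) * W x y)) / 2"
    unfolding fac_eq eq by (simp add: algebra_simps)
  then show ?thesis unfolding w osc_def by (simp add: power2_eq_square field_simps)
qed

lemma pos_of_shift:
  "pos_of (x + 1, y) = pos_of (x, y) + fac x y" "pos_of (x, y + 1) = pos_of (x, y) + fac x y * B"
  unfolding pos_of_def prod.case Z_shift om_shift fac_osc by (simp_all add: algebra_simps)

lemma psi_eq: "psi m = pos_of m - pos_of (0, 0)"
proof -
  obtain x y where m: "m = (x, y)" by fastforce
  have h: "hstep pa pb pc lam k 0 = pos_of (k + 1, 0) - pos_of (k, 0)" for k
    by (simp add: hstep_def pos_of_shift)
  have v: "vstep pa pb pc lam x k = pos_of (x, k + 1) - pos_of (x, k)" for k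
    by (simp add: vstep_def pos_of_shift)
  have "psi m = ((\<Sum>k\<in>{0..<x}. pos_of (k + 1, 0) - pos_of (k, 0)) - (\<Sum>k\<in>{x..<0}. pos_of (k + 1, 0) - pos_of (k, 0)))
    + ((\<Sum>k\<in>{0..<y}. pos_of (x, k + 1) - pos_of (x, k)) - (\<Sum>k\<in>{y..<0}. pos_of (x, k + 1) - pos_of (x, k)))"
    unfolding m tpsi_def prod.case h v by (simp only: add_diff_eq)
  also have "\<dots> = pos_of m - pos_of (0, 0)"
    unfolding int_sum_telescope[of "\<lambda>k. pos_of (k, 0)" x] int_sum_telescope[of "\<lambda>k. pos_of (x, k)" y]
    by (simp add: m)
  finally show ?thesis .
qed

section \<open>The quadratic harmonic function and the corrector\<close>

definition cb :: complex where "cb = cnj lam ^ 3 / 2 * (B * (1 - B) / (cnj B - B))"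
definition ca :: complex where "ca = cnj lam / 2 * (1 + 2 * B - B * (1 - B) / (cnj B - B))"

lemma cnj_lam: "cnj lam * lam = 1"
  by (metis complex_norm_square lam mult.commute of_real_1 power_one)

lemma Im_B: "Im B > 0"
  using sin_pos by (simp add: tB_def)

text \<open>These are the conditions for \<open>pos_of^2 - Q\<close> to have no linear growth in
  either lattice direction. As a system for \<open>ca\<close> and \<open>cb\<close> its determinant
  is a multiple of \<open>cnj B - B\<close>, nonzero because \<open>Im B > 0\<close>.\<close>

lemma ca_cb:
  "ca * (cnj lam / 2) + cb * (lam / 2) = cnj lam^2 / 4 * (1 + 2 * B)"
  "ca * (cnj lam / 2 * B) + cb * (lam / 2 * cnj B) = cnj lam^2 / 4 * (B^2 + 2 * B)"
proof -
  define b where "b = B * (1 - B) / (cnj B - B)"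
  have "cnj B - B \<noteq> 0" using Im_B by (auto simp: complex_eq_iff)
  then have b: "b * (cnj B - B) = B * (1 - B)" by (simp add: b_def)
  have cb: "cb * (lam / 2) = cnj lam^2 / 4 * b * (cnj lam * lam)"
    by (simp add: cb_def b_def[symmetric] power2_eq_square power3_eq_cube)
  have ca: "ca * (cnj lam / 2) = cnj lam^2 / 4 * (1 + 2 * B - b)"
    by (simp add: ca_def b_def[symmetric] power2_eq_square)
  show "ca * (cnj lam / 2) + cb * (lam / 2) = cnj lam^2 / 4 * (1 + 2 * B)"
    unfolding ca cb cnj_lam by (simp add: algebra_simps)
  have "ca * (cnj lam / 2 * B) + cb * (lam / 2 * cnj B) = (ca * (cnj lam / 2)) * B + (cb * (lam / 2)) * cnj B"
    by (simp add: algebra_simps)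
  also have "\<dots> = cnj lam^2 / 4 * (B + 2 * B^2 + b * (cnj B - B))"
    unfolding ca cb cnj_lam by (simp add: algebra_simps power2_eq_square)
  also have "\<dots> = cnj lam^2 / 4 * (B^2 + 2 * B)"
    unfolding b by (simp add: algebra_simps power2_eq_square)
  finally show "ca * (cnj lam / 2 * B) + cb * (lam / 2 * cnj B) = cnj lam^2 / 4 * (B^2 + 2 * B)" .
qed

text \<open>Functions affine on all segments are harmonic. Their slopes satisfy a constant-coefficient
  equation across white triangles, with solutions \<open>dirn\<close> (the linear functions) and \<open>Z * dirn\<close>;
  the latter integrates to a harmonic function asymptotic to \<open>pos_of^2\<close>. Up to linear functions,
  chosen through \<open>ca\<close> and \<open>cb\<close> to make the difference bounded, it is \<open>Q\<close>, and \<open>corr\<close> is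
  that difference.\<close>

definition corr :: "int \<times> int \<Rightarrow> complex" where
  "corr = (\<lambda>(x, y). om x y ^ 2 + om x y * (cnj lam * (1 + B + C) - ca) - cb * cnj (om x y))"

definition Q :: "int \<times> int \<Rightarrow> complex" where
  "Q m = pos_of m ^ 2 - corr m"

text \<open>The offsets \<open>B\<close> and \<open>1\<close> make all edges of the black face at
  \<open>(x, y)\<close> carry the same factor \<open>Z x y\<close>; this is what makes
  \<open>Q\<close> affine on its segment in \<open>face_Q\<close>.\<close>

lemma Q_shift:
  "Q (x + 1, y) = Q (x, y) + fac x y * (cnj lam * (Z x y - B) + ca) + cb * cnj (fac x y)"
  "Q (x, y + 1) = Q (x, y) + fac x y * B * (cnj lam * (Z x y - 1) + ca) + cb * cnj (fac x y * B)"
proof -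
  define l g c z where "l = cnj lam" "g = osc x y" "c = om x y" "z = Z x y"
  have cg: "c = C * g" by (simp add: l_g_c_z_def om_C)
  have lam: "lam = cnj l" by (simp add: l_g_c_z_def)
  note ab = ca_cb[unfolded l_g_c_z_def(1)[symmetric] lam]
  \<comment> \<open>The last bracket is the residue that \<open>ca_cb\<close> annihilates. The
    constant \<open>1 + B + C\<close> in \<open>corr\<close> is what balances the products of
    \<open>l\<close> with \<open>c\<close> and \<open>g\<close>, using
    \<open>c = C * g\<close>.\<close>
  have 1: "(l / 2 * (z + 1) + (c + g))^2 - ((c + g)^2 + (c + g) * (l * (1 + B + C) - ca) - cb * (cnj c + cnj g))
    = (l / 2 * z + c)^2 - (c^2 + c * (l * (1 + B + C) - ca) - cb * cnj c)
      + (l / 2 + g) * (l * (z - B) + ca) + cb * (cnj l / 2 + cnj g)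
      + (l^2 / 4 * (1 + 2 * B) - (ca * (l / 2) + cb * (cnj l / 2)))"
    unfolding cg by (simp add: field_simps power2_eq_square)
  have 2: "(l / 2 * (z + B) + (c + B * g))^2 - ((c + B * g)^2 + (c + B * g) * (l * (1 + B + C) - ca) - cb * (cnj c + cnj B * cnj g))
    = (l / 2 * z + c)^2 - (c^2 + c * (l * (1 + B + C) - ca) - cb * cnj c)
      + (l / 2 + g) * B * (l * (z - 1) + ca) + cb * ((cnj l / 2 + cnj g) * cnj B)
      + (l^2 / 4 * (B^2 + 2 * B) - (ca * (l / 2 * B) + cb * (cnj l / 2 * cnj B)))"
    unfolding cg by (simp add: field_simps power2_eq_square)
  show "Q (x + 1, y) = Q (x, y) + fac x y * (cnj lam * (Z x y - B) + ca) + cb * cnj (fac x y)"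
    using 1 ab(1) unfolding Q_def pos_of_def corr_def prod.case Z_shift om_shift fac_osc
    by (simp add: l_g_c_z_def)
  show "Q (x, y + 1) = Q (x, y) + fac x y * B * (cnj lam * (Z x y - 1) + ca) + cb * cnj (fac x y * B)"
    using 2 ab(2) unfolding Q_def pos_of_def corr_def prod.case Z_shift om_shift fac_osc
    by (simp add: l_g_c_z_def)
qed

definition dirn :: "int \<Rightarrow> int \<Rightarrow> complex" where "dirn x y = W x y * \<nu>"
definition slope :: "int \<Rightarrow> int \<Rightarrow> complex" where
  "slope x y = dirn x y * (cnj lam * Z x y + ca) + cb * cnj (dirn x y)"

lemma cmod_dirn: "cmod (dirn x y) = 1"
  by (simp add: dirn_def norm_mult)

lemma face_dirns:
  "fac x y * (B - 1) = of_real (\<alpha> * scl x y) * dirn x y"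
  "fac (x + 1) y * B = of_real (\<beta> * scl (x + 1) y) * dirn x y"
  using B_mu B_minus_1 by (simp_all add: fac_eq dirn_def W_shift mult.commute mult.left_commute)

lemma face_pos:
  "pos_of (x, y + 1) = pos_of (x + 1, y) + of_real (\<alpha> * scl x y) * dirn x y"
  "pos_of (x + 1, y + 1) = pos_of (x + 1, y) + of_real (\<beta> * scl (x + 1) y) * dirn x y"
  unfolding face_dirns[symmetric]
  using pos_of_shift[of x y] pos_of_shift(2)[of "x + 1" y] by (simp_all add: right_diff_distrib)

lemma face_Q:
  "Q (x, y + 1) = Q (x + 1, y) + of_real (\<alpha> * scl x y) * slope x y"
  "Q (x + 1, y + 1) = Q (x + 1, y) + of_real (\<beta> * scl (x + 1) y) * slope x y"
proof -
  have "Q (x, y + 1) = Q (x + 1, y) + fac x y * (B - 1) * (cnj lam * Z x y + ca) + cb * cnj (fac x y * (B - 1))"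
    unfolding Q_shift by (simp add: algebra_simps)
  then show "Q (x, y + 1) = Q (x + 1, y) + of_real (\<alpha> * scl x y) * slope x y"
    unfolding face_dirns slope_def by (simp add: algebra_simps)
  have "Q (x + 1, y + 1) = Q (x + 1, y) + fac (x + 1) y * B * (cnj lam * Z x y + ca) + cb * cnj (fac (x + 1) y * B)"
    unfolding Q_shift(2) Z_shift by simp
  then show "Q (x + 1, y + 1) = Q (x + 1, y) + of_real (\<beta> * scl (x + 1) y) * slope x y"
    unfolding face_dirns slope_def by (simp add: algebra_simps)
qed

section \<open>Segment lengths, and which sites lie inside which segments\<close>

definition Lmax :: real where "Lmax = \<alpha> + \<beta> + 1"
definition lmin :: real where "lmin = min \<alpha> \<beta> * (sin (pi * pc) / 3)"

lemma lmin_pos: "lmin > 0"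
  using \<alpha>_pos \<beta>_pos sin_pos by (simp add: lmin_def)

lemma scl_le_Lmax: "\<bar>\<alpha> * scl x y\<bar> \<le> Lmax" "\<bar>\<beta> * scl x y\<bar> \<le> Lmax" "\<bar>scl x y\<bar> \<le> Lmax"
proof -
  have "\<bar>\<alpha> * scl x y\<bar> \<le> \<alpha>" "\<bar>\<beta> * scl x y\<bar> \<le> \<beta>"
    using abs_scl_le[of x y] \<alpha>_pos \<beta>_pos by (simp_all add: abs_mult)
  then show "\<bar>\<alpha> * scl x y\<bar> \<le> Lmax" "\<bar>\<beta> * scl x y\<bar> \<le> Lmax" "\<bar>scl x y\<bar> \<le> Lmax"
    using abs_scl_le[of x y] \<alpha>_pos \<beta>_pos unfolding Lmax_def by linarith+
qed

text \<open>If \<open>Re w\<close> and \<open>Re (w * \<mu>)\<close> were both below a third of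
  \<open>sin (pi * pc)\<close>, then |Re w| < 1/3 and |Im w| < 2/3, impossible for a unit vector
  since 1/9 + 4/9 < 1. This explains the factor in \<open>lmin\<close>.\<close>

lemma lmin_le:
  assumes "\<bar>\<alpha> * scl x y\<bar> \<le> d" "\<bar>\<beta> * scl (x + 1) y\<bar> \<le> d"
  shows "lmin \<le> d"
proof (rule ccontr)
  assume "\<not> lmin \<le> d"
  define w where "w = lam * W x y"
  define S where "S = sin (pi * pc)"
  have S: "0 < S" "S \<le> 1" using sin_pos by (auto simp: S_def)
  have w: "(Re w)^2 + (Im w)^2 = 1"
    unfolding w_def using lam by (metis cmod_W cmod_power2 mult_1 norm_mult power_one)
  have "\<alpha> * \<bar>Re w\<bar> < min \<alpha> \<beta> * (S / 3)" "\<beta> * \<bar>Re (w * \<mu>)\<bar> < min \<alpha> \<beta> * (S / 3)"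
    using assms \<open>\<not> lmin \<le> d\<close> \<alpha>_pos \<beta>_pos
    unfolding lmin_def S_def scl_eq w_def W_shift by (auto simp: abs_mult mult.assoc)
  moreover have "min \<alpha> \<beta> * (S / 3) \<le> \<alpha> * (S / 3)" "min \<alpha> \<beta> * (S / 3) \<le> \<beta> * (S / 3)"
    using S by (auto intro!: mult_right_mono)
  ultimately have "\<alpha> * \<bar>Re w\<bar> < \<alpha> * (S / 3)" "\<beta> * \<bar>Re (w * \<mu>)\<bar> < \<beta> * (S / 3)" by linarith+
  then have 1: "\<bar>Re w\<bar> < S / 3" "\<bar>Re (w * \<mu>)\<bar> < S / 3" using \<alpha>_pos \<beta>_pos by simp_all
  define q where "q = Re (w * \<mu>)"
  have q: "\<bar>q\<bar> < S / 3" using 1(2) by (simp only: q_def)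
  have "Im w * S = Re w * cos (pi * pc) - q" by (simp add: tmu_def S_def q_def)
  moreover have "\<bar>Re w * cos (pi * pc)\<bar> \<le> \<bar>Re w\<bar>"
    using mult_left_mono[OF abs_cos_le_one[of "pi * pc"], of "\<bar>Re w\<bar>"] by (simp add: abs_mult)
  ultimately have "\<bar>Im w * S\<bar> < 2 / 3 * S" using 1(1) q by linarith
  then have "\<bar>Im w\<bar> * S < 2 / 3 * S" using S by (simp add: abs_mult)
  then have "\<bar>Im w\<bar> < 2 / 3" using S by simp
  then have "(Im w)^2 < (2/3)^2" by (metis abs_ge_zero power2_abs power_strict_mono zero_less_numeral)
  moreover have "\<bar>Re w\<bar> < 1 / 3" using 1(1) S by linarith
  then have "(Re w)^2 < (1/3)^2" by (metis abs_ge_zero power2_abs power_strict_mono zero_less_numeral)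
  ultimately show False using w by (simp add: power2_eq_square)
qed

text \<open>\<open>F\<close> is the slope of \<open>Q\<close> along the segment; since it goes with
  the same \<open>s\<close> and \<open>t\<close> as \<open>u\<close>, \<open>Q\<close> is affine
  there and hence harmonic at \<open>m\<close>. The lower bound concerns the whole segment, not the
  single jumps.\<close>

definition between :: "int \<times> int \<Rightarrow> int \<times> int \<Rightarrow> int \<times> int \<Rightarrow> bool" where
  "between m m1 m2 \<longleftrightarrow> convex hull {psi m, psi m1, psi m2} \<in> tsegments pa pb pc lam \<and>
    (\<exists>u F s t. cmod u = 1 \<and> 0 < s \<and> s \<le> Lmax \<and> 0 < t \<and> t \<le> Lmax \<and> lmin \<le> s + t \<and>
      pos_of m1 = pos_of m + of_real s * u \<and> pos_of m2 = pos_of m - of_real t * u \<and>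
      Q m1 = Q m + of_real s * F \<and> Q m2 = Q m - of_real t * F)"

lemma betweenI:
  assumes "convex hull {psi m, psi m1, psi m2} \<in> tsegments pa pb pc lam"
    and "cmod u = 1" "s * t < 0" "\<bar>s\<bar> \<le> Lmax" "\<bar>t\<bar> \<le> Lmax" "lmin \<le> \<bar>s - t\<bar>"
    and "pos_of m1 = pos_of m + of_real s * u" "pos_of m2 = pos_of m + of_real t * u"
    and "Q m1 = Q m + of_real s * F" "Q m2 = Q m + of_real t * F"
  shows "between m m1 m2"
proof (cases "s > 0")
  case True
  then have "t < 0" using assms(3) by (simp add: mult_less_0_iff)
  then show ?thesis unfolding between_def using assms True
    by (intro conjI exI[of _ u] exI[of _ F] exI[of _ s] exI[of _ "- t"]) auto
next
  case False
  then have "s < 0" "t > 0" using assms(3) by (auto simp: mult_less_0_iff)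
  then show ?thesis unfolding between_def using assms
    by (intro conjI exI[of _ "- u"] exI[of _ "- F"] exI[of _ "- s"] exI[of _ t]) auto
qed

lemma tseg_in: "convex hull {psi (x + 1, y), psi (x, y + 1), psi (x + 1, y + 1)} \<in> tsegments pa pb pc lam"
  unfolding tsegments_def by (intro range_eqI[of _ _ "(x, y)"]) (simp add: tseg_def)

text \<open>A site is a corner of three black faces, based at \<open>(x - 1, y)\<close>,
  \<open>(x, y - 1)\<close> and \<open>(x - 1, y - 1)\<close>, one per type. It is the middle point
  of the collapsed face when its two edges there point in opposite directions, which is the sign
  condition.\<close>

lemma between_type1:
  assumes "scl x y * scl (x - 1) y < 0"
  shows "between (x, y) (x - 1, y + 1) (x, y + 1)"
proof (rule betweenI[where u = "dirn (x - 1) y" and F = "slope (x - 1) y"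
      and s = "\<alpha> * scl (x - 1) y" and t = "\<beta> * scl x y"])
  show "convex hull {psi (x, y), psi (x - 1, y + 1), psi (x, y + 1)} \<in> tsegments pa pb pc lam"
    using tseg_in[of "x - 1" y] by simp
  have "\<alpha> * scl (x - 1) y * (\<beta> * scl x y) = (\<alpha> * \<beta>) * (scl x y * scl (x - 1) y)" by simp
  then show st: "\<alpha> * scl (x - 1) y * (\<beta> * scl x y) < 0"
    using assms \<alpha>_pos \<beta>_pos by (metis mult_pos_neg mult_pos_pos)
  show "lmin \<le> \<bar>\<alpha> * scl (x - 1) y - \<beta> * scl x y\<bar>"
    using opposite_sign_abs[OF st] by (intro lmin_le[of "x - 1" y]) auto
qed (use face_pos[of "x - 1" y] face_Q[of "x - 1" y] in \<open>auto simp: cmod_dirn scl_le_Lmax\<close>)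

lemma between_type2:
  assumes "scl x y * scl x (y - 1) > 0"
  shows "between (x, y) (x + 1, y - 1) (x + 1, y)"
proof (rule betweenI[where u = "dirn x (y - 1)" and F = "slope x (y - 1)"
      and s = "- \<alpha> * scl x (y - 1)" and t = "scl x y"])
  show "convex hull {psi (x, y), psi (x + 1, y - 1), psi (x + 1, y)} \<in> tsegments pa pb pc lam"
    using tseg_in[of x "y - 1"] by (simp add: insert_commute)
  have "- \<alpha> * scl x (y - 1) * scl x y = - \<alpha> * (scl x y * scl x (y - 1))" by simp
  then show st: "- \<alpha> * scl x (y - 1) * scl x y < 0"
    using assms \<alpha>_pos by (metis mult_neg_pos neg_less_0_iff_less)
  \<comment> \<open>The edge opposite to the site is the whole segment, so its length is the sum of
    the two jump lengths.\<close>
  have r: "\<beta> * scl (x + 1) (y - 1) = \<alpha> * scl x (y - 1) + scl x y" using scl_rel[of x "y - 1"] by simp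
  show "lmin \<le> \<bar>- \<alpha> * scl x (y - 1) - scl x y\<bar>"
    using opposite_sign_abs[OF st] by (intro lmin_le[of x "y - 1"]) (auto simp: r)
  have t: "scl x y = \<beta> * scl (x + 1) (y - 1) - \<alpha> * scl x (y - 1)" using r by simp
  show "pos_of (x + 1, y) = pos_of (x, y) + of_real (scl x y) * dirn x (y - 1)"
    unfolding t using face_pos[of x "y - 1"] by (simp add: algebra_simps)
  show "Q (x + 1, y) = Q (x, y) + of_real (scl x y) * slope x (y - 1)"
    unfolding t using face_Q[of x "y - 1"] by (simp add: algebra_simps)
qed (use face_pos[of x "y - 1"] face_Q[of x "y - 1"] scl_le_Lmax in \<open>auto simp: cmod_dirn\<close>)

lemma between_type3:
  assumes "scl (x - 1) y * scl x (y - 1) < 0"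
  shows "between (x, y) (x, y - 1) (x - 1, y)"
proof (rule betweenI[where u = "dirn (x - 1) (y - 1)" and F = "slope (x - 1) (y - 1)"
      and s = "- \<beta> * scl x (y - 1)" and t = "- scl (x - 1) y"])
  show "convex hull {psi (x, y), psi (x, y - 1), psi (x - 1, y)} \<in> tsegments pa pb pc lam"
    using tseg_in[of "x - 1" "y - 1"] by (simp add: insert_commute)
  have "- \<beta> * scl x (y - 1) * - scl (x - 1) y = \<beta> * (scl (x - 1) y * scl x (y - 1))" by simp
  then show st: "- \<beta> * scl x (y - 1) * - scl (x - 1) y < 0"
    using assms \<beta>_pos by (metis mult_pos_neg)
  have r: "\<alpha> * scl (x - 1) (y - 1) = \<beta> * scl x (y - 1) - scl (x - 1) y" using scl_rel[of "x - 1" "y - 1"] by simp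
  show "lmin \<le> \<bar>- \<beta> * scl x (y - 1) - - scl (x - 1) y\<bar>"
    using opposite_sign_abs[OF st] by (intro lmin_le[of "x - 1" "y - 1"]) (auto simp: r)
  have t: "scl (x - 1) y = \<beta> * scl x (y - 1) - \<alpha> * scl (x - 1) (y - 1)" using r by simp
  show "pos_of (x - 1, y) = pos_of (x, y) + of_real (- scl (x - 1) y) * dirn (x - 1) (y - 1)"
    unfolding t using face_pos[of "x - 1" "y - 1"] by (simp add: algebra_simps)
  show "Q (x - 1, y) = Q (x, y) + of_real (- scl (x - 1) y) * slope (x - 1) (y - 1)"
    unfolding t using face_Q[of "x - 1" "y - 1"] by (simp add: algebra_simps)
qed (use face_pos[of "x - 1" "y - 1"] face_Q[of "x - 1" "y - 1"] scl_le_Lmax in \<open>auto simp: cmod_dirn\<close>)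

end

context tgraph
begin

text \<open>Under the generator the linear part of \<open>pos_of^2\<close> cancels, leaving
  \<open>(s + t) * u^2\<close>, while \<open>Q\<close> contributes zero.\<close>

lemma between_corr:
  assumes "pos_of m1 = pos_of m + of_real s * u" "pos_of m2 = pos_of m - of_real t * u"
    and "Q m1 = Q m + of_real s * F" "Q m2 = Q m - of_real t * F" "0 < s" "0 < t"
  shows "(corr m1 - corr m) / of_real s + (corr m2 - corr m) / of_real t = of_real (s + t) * u^2"
proof -
  have c: "corr m = pos_of m ^ 2 - Q m" for m by (simp add: Q_def)
  have "corr m1 - corr m = of_real s * (2 * pos_of m * u + of_real s * u^2 - F)"
    unfolding c assms(1,3) by (simp add: algebra_simps power2_eq_square)
  moreover have "corr m2 - corr m = of_real t * (of_real t * u^2 - 2 * pos_of m * u + F)"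
    unfolding c assms(2,4) by (simp add: algebra_simps power2_eq_square)
  ultimately show ?thesis using assms(5,6) by (simp add: distrib_right)
qed

lemma cmod_om: "cmod (om x y) = cmod C / 2"
  using lam by (simp add: om_def norm_mult norm_power norm_divide)

lemma corr_bounded: "\<exists>X. \<forall>m. cmod (corr m) \<le> X"
proof (intro exI allI)
  fix m :: "int \<times> int"
  obtain x y where m: "m = (x, y)" by fastforce
  have "cmod (corr m) \<le> cmod (om x y ^ 2 + om x y * (cnj lam * (1 + B + C) - ca)) + cmod (cb * cnj (om x y))"
    unfolding m corr_def prod.case by (rule norm_triangle_ineq4)
  also have "\<dots> \<le> cmod (om x y ^ 2) + cmod (om x y * (cnj lam * (1 + B + C) - ca)) + cmod (cb * cnj (om x y))"
    by (intro add_right_mono norm_triangle_ineq)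
  also have "\<dots> = (cmod C / 2)^2 + cmod C / 2 * cmod (cnj lam * (1 + B + C) - ca) + cmod cb * (cmod C / 2)"
    by (simp add: norm_mult norm_power cmod_om)
  finally show "cmod (corr m) \<le> (cmod C / 2)^2 + cmod C / 2 * cmod (cnj lam * (1 + B + C) - ca) + cmod cb * (cmod C / 2)" .
qed

text \<open>\<open>Z\<close> embeds the lattice discretely because \<open>Im B > 0\<close>, and
  \<open>om\<close> has constant modulus.\<close>

lemma finite_pos_of_bounded: "finite {m. cmod (pos_of m) \<le> K}"
proof -
  define M where "M = 2 * K + cmod C"
  define N where "N = \<lceil>M / Im B\<rceil>"
  define N' where "N' = \<lceil>M + cmod B * \<bar>of_int N\<bar>\<rceil>"
  have "{m. cmod (pos_of m) \<le> K} \<subseteq> {-N'..N'} \<times> {-N..N}"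
  proof clarify
    fix x y assume "cmod (pos_of (x, y)) \<le> K"
    moreover have eq: "cnj lam / 2 * Z x y = pos_of (x, y) - om x y" by (simp add: pos_of_def)
    have "cmod (cnj lam / 2 * Z x y) \<le> cmod (pos_of (x, y)) + cmod C / 2"
      unfolding eq using norm_triangle_ineq4[of "pos_of (x, y)" "om x y"] by (simp add: cmod_om)
    ultimately have Z: "cmod (Z x y) \<le> M" using lam by (simp add: norm_mult norm_divide M_def)
    have "\<bar>Im (Z x y)\<bar> = Im B * \<bar>of_int y\<bar>" using Im_B by (simp add: Z_def abs_mult)
    then have "Im B * \<bar>of_int y\<bar> \<le> M" using abs_Im_le_cmod[of "Z x y"] Z by linarith
    then have "\<bar>real_of_int y\<bar> \<le> M / Im B" using Im_B by (simp add: field_simps)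
    then have y: "\<bar>real_of_int y\<bar> \<le> of_int N" unfolding N_def by linarith
    have "of_int x = Z x y - B * of_int y" by (simp add: Z_def)
    then have "cmod (of_int x) \<le> cmod (Z x y) + cmod (B * of_int y)" by (metis norm_triangle_ineq4)
    also have "\<dots> \<le> M + cmod B * \<bar>of_int N\<bar>"
      unfolding norm_mult norm_of_int using Z y by (intro add_mono mult_left_mono) auto
    finally have "\<bar>real_of_int x\<bar> \<le> of_int N'" unfolding N'_def norm_of_int by linarith
    with y show "x \<in> {-N'..N'} \<and> y \<in> {-N..N}" by auto
  qed
  then show ?thesis by (rule finite_subset) auto
qed

section \<open>The phase of a lattice site\<close>

definition phase0 :: real where "phase0 = Arg lam / pi + 1 / 2"

definition phase :: "int \<Rightarrow> int \<Rightarrow> real" where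
  "phase x y = phase0 + pc * of_int x - pb * of_int y"

text \<open>\<open>\<nu>\<close> has argument \<open>pi - pi * pb\<close>; the extra
  \<open>pi\<close> per unit of \<open>y\<close> becomes the sign in front, and the half in
  \<open>phase0\<close> turns the cosine into a sine vanishing at integer phases.\<close>

lemma scl_phase: "scl x y = cos (pi * of_int y) * sin (pi * phase x y)"
proof -
  have l: "lam = cis (Arg lam)" using lam cis_Arg[of lam] by (metis div_by_1 norm_zero of_real_1 sgn_eq zero_neq_one)
  have n: "\<nu> = cis (pi - pi * pb)" by (simp add: tnu_def complex_eq_iff)
  have W: "W x y = cis (of_int x * (pi * pc) + of_int y * (pi - pi * pb))"
    unfolding W_def n tmu_def cis_power_int cis_mult ..
  have "scl x y = cos (Arg lam + (of_int x * (pi * pc) + of_int y * (pi - pi * pb)))"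
    unfolding scl_eq W by (subst l) (simp only: cis_mult cis.sel)
  also have "Arg lam + (of_int x * (pi * pc) + of_int y * (pi - pi * pb)) = (pi * phase x y + pi * of_int y) - pi / 2"
    by (simp add: phase_def phase0_def algebra_simps)
  also have "cos \<dots> = sin (pi * phase x y + pi * of_int y)" by (simp add: cos_diff)
  also have "\<dots> = cos (pi * of_int y) * sin (pi * phase x y)" by (simp add: sin_add)
  finally show ?thesis .
qed

lemma phase_shift:
  "phase (x - 1) y = phase x y - pc" "phase x (y - 1) = phase x y + pb"
  by (simp_all add: phase_def algebra_simps)

text \<open>Shifting by \<open>k\<close> multiplies every sine by the same sign, which squares away;
  the minus signs come from the change of parity between \<open>y\<close> and
  \<open>y - 1\<close>.\<close>

lemma type_prods:
  "scl x y * scl (x - 1) y = sin (pi * (phase x y - of_int k)) * sin (pi * (phase x y - of_int k - pc))"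
  "scl x y * scl x (y - 1) = - (sin (pi * (phase x y - of_int k)) * sin (pi * (phase x y - of_int k + pb)))"
  "scl (x - 1) y * scl x (y - 1) = - (sin (pi * (phase x y - of_int k - pc)) * sin (pi * (phase x y - of_int k + pb)))"
proof -
  define r where "r = phase x y - of_int k"
  define e where "e = cos (pi * real_of_int y)"
  define f where "f = cos (pi * real_of_int k)"
  have ef: "e * e = 1" "f * f = 1" by (simp_all add: e_def f_def cos_pi_int_sq)
  have p: "phase x y = of_int k + r" by (simp add: r_def)
  have 1: "scl x y = e * (f * sin (pi * r))"
    unfolding scl_phase p e_def f_def sin_pi_shift ..
  have 2: "scl (x - 1) y = e * (f * sin (pi * (r - pc)))"
    unfolding scl_phase phase_shift p e_def f_def sin_pi_shift[symmetric] by (simp add: algebra_simps)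
  have c: "cos (pi * real_of_int (y - 1)) = - e"
    unfolding e_def by (simp add: right_diff_distrib cos_diff)
  have 3: "scl x (y - 1) = - e * (f * sin (pi * (r + pb)))"
    unfolding scl_phase phase_shift p c add.assoc f_def sin_pi_shift ..
  have "scl x y * scl (x - 1) y = (e * e) * (f * f) * (sin (pi * r) * sin (pi * (r - pc)))"
    unfolding 1 2 by (simp only: mult_ac)
  then show "scl x y * scl (x - 1) y = sin (pi * (phase x y - of_int k)) * sin (pi * (phase x y - of_int k - pc))"
    unfolding ef r_def by simp
  have "scl x y * scl x (y - 1) = - ((e * e) * (f * f) * (sin (pi * r) * sin (pi * (r + pb))))"
    unfolding 1 3 by (simp add: mult_ac)
  then show "scl x y * scl x (y - 1) = - (sin (pi * (phase x y - of_int k)) * sin (pi * (phase x y - of_int k + pb)))"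
    unfolding ef r_def by simp
  have "scl (x - 1) y * scl x (y - 1) = - ((e * e) * (f * f) * (sin (pi * (r - pc)) * sin (pi * (r + pb))))"
    unfolding 2 3 by (simp add: mult_ac)
  then show "scl (x - 1) y * scl x (y - 1) = - (sin (pi * (phase x y - of_int k - pc)) * sin (pi * (phase x y - of_int k + pb)))"
    unfolding ef r_def by simp
qed

lemma sin_pi_pos: "0 < r \<Longrightarrow> r < 1 \<Longrightarrow> 0 < sin (pi * r)"
  by (intro sin_gt_zero) auto

lemma sin_pi_neg: "- 1 < r \<Longrightarrow> r < 0 \<Longrightarrow> sin (pi * r) < 0"
  using sin_pi_pos[of "- r"] by simp

lemma phase_type1:
  assumes "of_int k < phase x y" "phase x y < of_int k + pc"
  shows "between (x, y) (x - 1, y + 1) (x, y + 1)"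
  using assms less1 pos
  by (intro between_type1, subst type_prods(1)[of _ _ k]) (auto intro!: mult_pos_neg sin_pi_pos sin_pi_neg)

lemma phase_type2:
  assumes "of_int k - pb < phase x y" "phase x y < of_int k"
  shows "between (x, y) (x + 1, y - 1) (x + 1, y)"
  using assms less1 pos
  by (intro between_type2, subst type_prods(2)[of _ _ k])
    (auto intro!: mult_neg_pos sin_pi_pos sin_pi_neg)

lemma phase_type3:
  assumes "of_int k + pc < phase x y" "phase x y < of_int k + 1 - pb"
  shows "between (x, y) (x, y - 1) (x - 1, y)"
  using assms less1 pos
  by (intro between_type3, subst type_prods(3)[of _ _ k])
    (auto intro!: mult_pos_pos sin_pi_pos)

end

locale nondegenerate = tgraph +
  assumes nondeg: "nondegenerate_tgraph pa pb pc lam"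
begin

section \<open>The walk on a non-degenerate T-graph\<close>

abbreviation "V \<equiv> tvertices pa pb pc lam"
abbreviation "nb \<equiv> tnbrs pa pb pc lam"
abbreviation "jump \<equiv> tjump pa pb pc lam"

lemma scl_nonzero: "scl x y \<noteq> 0"
proof
  assume "scl x y = 0"
  then have "fac x y = 0" by (simp add: fac_eq)
  then have "psi (x, y) = psi (x + 1, y) \<and> psi (x, y) = psi (x, y + 1)"
    by (simp add: psi_eq pos_of_shift)
  then show False using nondeg unfolding nondegenerate_tgraph_def by blast
qed

text \<open>If the first and third sign conditions both fail, the three nonzero scales have the same
  sign, and then the second one holds.\<close>

lemma between_exists: "\<exists>m1 m2. between m m1 m2"
proof -
  obtain x y where m: "m = (x, y)" by fastforce
  have "scl x y * scl (x - 1) y < 0 \<or> scl x y * scl x (y - 1) > 0 \<or> scl (x - 1) y * scl x (y - 1) < 0"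
    using scl_nonzero[of x y] scl_nonzero[of "x - 1" y] scl_nonzero[of x "y - 1"]
    by (auto simp: mult_less_0_iff zero_less_mult_iff linorder_neq_iff)
  then show ?thesis unfolding m using between_type1 between_type2 between_type3 by blast
qed

text \<open>\<open>between\<close> exhibits a segment with \<open>psi m\<close> in its interior;
  non-degeneracy allows a single one, so it is the carrier.\<close>

lemma tnbrs_eq:
  assumes "between m m1 m2"
  shows "nb (psi m) = {psi m1, psi m2}"
proof -
  define v where "v = psi m"
  define S where "S = convex hull {psi m, psi m1, psi m2}"
  obtain u s t where ust: "cmod u = 1" "0 < s" "0 < t"
    "pos_of m1 = pos_of m + of_real s * u" "pos_of m2 = pos_of m - of_real t * u"
    using assms by (auto simp: between_def)
  have p: "psi m1 = v + of_real s * u" "psi m2 = v - of_real t * u"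
    unfolding v_def psi_eq ust by simp_all
  have ne: "psi m1 \<noteq> v" "psi m2 \<noteq> v" "psi m1 \<noteq> psi m2"
  proof -
    have u: "u \<noteq> 0" using ust by auto
    then show "psi m1 \<noteq> v" "psi m2 \<noteq> v" using ust unfolding p by auto
    have "psi m1 - psi m2 = of_real (s + t) * u" unfolding p by (simp add: algebra_simps)
    then show "psi m1 \<noteq> psi m2" using u ust
      by (metis add_pos_pos diff_self less_irrefl mult_eq_0_iff of_real_eq_0_iff)
  qed
  define k where "k = s / (s + t)"
  have "(1 - k) * s = k * t" using ust by (simp add: k_def field_simps)
  then have eq: "of_real (1 - k) * (of_real s * u) = of_real k * (of_real t * u)"
    by (metis (no_types) mult.assoc of_real_mult)
  have "v = (1 - k) *\<^sub>R psi m1 + k *\<^sub>R psi m2"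
    unfolding p scaleR_conv_of_real distrib_left right_diff_distrib eq by (simp add: algebra_simps)
  moreover have "0 \<le> k" "k \<le> 1" using ust by (auto simp: k_def)
  ultimately have seg: "v \<in> closed_segment (psi m1) (psi m2)" by (auto simp: closed_segment_def)
  have S: "S = closed_segment (psi m1) (psi m2)"
    using seg unfolding S_def v_def segment_convex_hull by (simp add: hull_redundant)
  have ext: "w extreme_point_of S \<longleftrightarrow> w = psi m1 \<or> w = psi m2" for w
    unfolding S by (rule extreme_point_of_segment)
  have vS: "S \<in> tsegments pa pb pc lam" "v \<in> seg_interior S"
    using assms seg ne ext unfolding between_def S_def[symmetric] by (auto simp: seg_interior_def S)
  have "card {S \<in> tsegments pa pb pc lam. v \<in> seg_interior S} = 1"
    using nondeg unfolding nondegenerate_tgraph_def v_def tvertices_def by blast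
  then obtain T where T: "{S \<in> tsegments pa pb pc lam. v \<in> seg_interior S} = {T}"
    by (rule card_1_singletonE)
  then have "tcarrier pa pb pc lam v = S"
    unfolding tcarrier_def using vS by (intro the_equality) blast+
  then show ?thesis using ext by (auto simp: tnbrs_def v_def)
qed

text \<open>Jump probabilities inversely proportional to the distances: this is the martingale
  property.\<close>

lemma jump_eq:
  assumes "pos_of m1 = pos_of m + of_real s * u" "pos_of m2 = pos_of m - of_real t * u"
    "cmod u = 1" "0 < s" "0 < t" and nb: "nb (psi m) = {psi m1, psi m2}"
  shows "psi m1 \<noteq> psi m2" "jump (psi m) (psi m1) = t / (s + t)" "jump (psi m) (psi m2) = s / (s + t)"
proof -
  have "psi m1 - psi m2 = of_real (s + t) * u" unfolding psi_eq assms by (simp add: algebra_simps)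
  moreover have "of_real (s + t) * u \<noteq> 0" using assms by (auto simp del: of_real_add)
  ultimately show ne: "psi m1 \<noteq> psi m2" by auto
  have "cmod (psi m1 - psi m) = s" "cmod (psi m2 - psi m) = t"
    unfolding psi_eq assms using assms by (simp_all add: norm_mult)
  then have r: "trate pa pb pc lam (psi m) (psi m1) = 1 / s" "trate pa pb pc lam (psi m) (psi m2) = 1 / t"
    using nb by (simp_all add: trate_def)
  show "jump (psi m) (psi m1) = t / (s + t)" "jump (psi m) (psi m2) = s / (s + t)"
    unfolding tjump_def nb using ne assms by (simp_all add: r field_simps)
qed

lemma connected: "(psi m, psi m') \<in> {(u, w). w \<in> nb u}\<^sup>*"
proof -
  \<comment> \<open>Reachability is pulled back to lattice sites, where the phase is
    defined.\<close>
  define R where "R = {m'. (psi m, psi m') \<in> {(u, w). w \<in> nb u}\<^sup>*}"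
  have step: "m1 \<in> R \<and> m2 \<in> R" if "n \<in> R" "between n m1 m2" for n m1 m2
    using that tnbrs_eq[OF that(2)] by (auto simp: R_def intro: rtrancl_into_rtrancl)
  interpret phase_steps pb pc phase0 R phase
  proof (unfold_locales)
    show "phase \<equiv> \<lambda>x y. phase0 + pc * of_int x - pb * of_int y" by (simp add: phase_def[abs_def])
    show "0 < pb" "0 < pc" "pb + pc < 1" using pos sum1 by auto
    show "phase0 + pc * of_int x - pb * of_int y \<noteq> of_int k" for x y k
      using scl_nonzero[of x y] unfolding scl_phase phase_def[symmetric] by auto
  qed (unfold phase_def[symmetric]; blast intro!: step phase_type1 phase_type2 phase_type3)+
  have "m \<in> R" by (simp add: R_def)
  then have "R \<noteq> {}" by blast
  then show ?thesis using closed_set_UNIV by (auto simp: R_def)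
qed

lemma chain: "positive_chain jump nb V"
proof
  fix u assume "u \<in> V"
  then obtain m where m: "u = psi m" by (auto simp: tvertices_def)
  obtain m1 m2 where b: "between m m1 m2" using between_exists by blast
  note nb = tnbrs_eq[OF b]
  obtain e s t where est: "cmod e = 1" "0 < s" "0 < t"
    "pos_of m1 = pos_of m + of_real s * e" "pos_of m2 = pos_of m - of_real t * e"
    using b by (auto simp: between_def)
  note j = jump_eq[OF est(4,5,1,2,3) nb]
  show "finite (nb u)" "nb u \<subseteq> V" unfolding m nb by (auto simp: tvertices_def)
  show "0 < jump u w" if "w \<in> nb u" for w using that est unfolding m nb by (auto simp: j)
  show "sum (jump u) (nb u) = 1" unfolding m nb using j est by (simp add: add_divide_distrib[symmetric])
next
  show "(u, v) \<in> {(u, w). w \<in> nb u}\<^sup>*" if "u \<in> V" "v \<in> V" for u v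
    using that connected by (auto simp: tvertices_def)
qed

section \<open>The Lyapunov function on the vertices\<close>

definition height :: "int \<times> int \<Rightarrow> real" where "height m = lyap (pos_of m) (corr m)"

text \<open>\<open>psi\<close> need not be known to be injective: the minimum over a fibre of a function that is
  superharmonic on the lattice is superharmonic on the image.\<close>

definition min_height :: "complex \<Rightarrow> real" where "min_height v = Min (height ` {m. psi m = v})"

lemma finite_fibre: "finite {m. psi m = v}"
proof (rule finite_subset[OF _ finite_pos_of_bounded])
  show "{m. psi m = v} \<subseteq> {m. cmod (pos_of m) \<le> cmod (v + pos_of (0, 0))}" by (auto simp: psi_eq)
qed

lemma min_height_le: "min_height (psi m) \<le> height m"
  unfolding min_height_def using finite_fibre by (intro Min_le) auto

lemma min_height_attained:
  assumes "v \<in> V" obtains m where "psi m = v" "height m = min_height v"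
proof -
  have "min_height v \<in> height ` {m. psi m = v}"
    unfolding min_height_def using assms finite_fibre by (intro Min_in) (auto simp: tvertices_def)
  then show ?thesis using that by auto
qed

lemma finite_sublevel: "finite {v \<in> V. min_height v \<le> K}"
proof -
  obtain X where X: "\<And>m. cmod (corr m) \<le> X" using corr_bounded by blast
  have "{v \<in> V. min_height v \<le> K} \<subseteq> psi ` {m. cmod (pos_of m) \<le> 1 + exp (K + 1 + 2 * X)}"
  proof clarify
    fix v assume "v \<in> V" "min_height v \<le> K"
    then obtain m where m: "psi m = v" "height m \<le> K" using min_height_attained by metis
    define n where "n = cmod (pos_of m)"
    have "n \<le> 1 + exp (K + 1 + 2 * X)"
    proof (cases "n \<ge> 1")
      case True
      then have "ln (n^2) \<le> K + 1 + 2 * X"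
        using lyap_ge_ln[OF _ X[of m], of "pos_of m"] m by (simp add: height_def n_def)
      then have "exp (ln (n^2)) \<le> exp (K + 1 + 2 * X)" by simp
      then have "n^2 \<le> exp (K + 1 + 2 * X)" using True by (simp del: exp_le_cancel_iff)
      moreover have "n \<le> n^2" using True by (simp add: power2_eq_square)
      ultimately show ?thesis by linarith
    qed (simp add: add_increasing2)
    then show "v \<in> psi ` {m. cmod (pos_of m) \<le> 1 + exp (K + 1 + 2 * X)}" using m by (auto simp: n_def)
  qed
  then show ?thesis by (rule finite_subset) (intro finite_imageI finite_pos_of_bounded)
qed

theorem recurrent: "tgraph_walk_recurrent pa pb pc lam"
proof -
  interpret positive_chain jump nb V by (rule chain)
  obtain X where X: "\<And>m. cmod (corr m) \<le> X" using corr_bounded by blast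
  define D where "D = 16 * (64 * Lmax + 160 * X / lmin)"
  \<comment> \<open>Collects the thresholds of \<open>lyap_superharmonic_far\<close>;
    \<open>D\<close> is squared because it is compared with a square root.\<close>
  define r0 where "r0 = 2 + 2 * Lmax + D^2"
  have Lm: "Lmax > 0" using \<alpha>_pos \<beta>_pos by (simp add: Lmax_def)
  have super: "(\<Sum>w\<in>nb v. jump v w * min_height w) \<le> min_height v"
    if v: "v \<in> V - psi ` {m. cmod (pos_of m) \<le> r0}" for v
  proof -
    obtain m where m: "psi m = v" "height m = min_height v" using min_height_attained v by blast
    have r: "cmod (pos_of m) > r0" using v m by force
    obtain m1 m2 where b: "between m m1 m2" using between_exists by blast
    note nb = tnbrs_eq[OF b]
    obtain u F s t where ust: "cmod u = 1" "0 < s" "s \<le> Lmax" "0 < t" "t \<le> Lmax" "lmin \<le> s + t"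
      and p: "pos_of m1 = pos_of m + of_real s * u" "pos_of m2 = pos_of m - of_real t * u"
      and q: "Q m1 = Q m + of_real s * F" "Q m2 = Q m - of_real t * F"
      using b by (auto simp: between_def)
    note j = jump_eq[OF p ust(1,2,4) nb]
    have "D^2 \<ge> 0" by simp
    then have "2 \<le> cmod (pos_of m)" "2 * Lmax \<le> cmod (pos_of m)" "D^2 \<le> cmod (pos_of m)"
      using r Lm unfolding r0_def by linarith+
    moreover from this(3) have "D \<le> sqrt (cmod (pos_of m))" by (rule real_le_rsqrt)
    ultimately have "(height m1 - height m) / s + (height m2 - height m) / t \<le> 0"
      unfolding height_def p
      using lyap_superharmonic_far[OF ust(1-5) lmin_pos ust(6) X X between_corr[OF p q ust(2,4)]]
      by (simp add: D_def)
    \<comment> \<open>Multiplying by \<open>s * t\<close> turns the rates into the jump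
      probabilities, up to the factor \<open>s + t\<close>.\<close>
    then have "((height m1 - height m) / s + (height m2 - height m) / t) * (s * t) \<le> 0"
      using ust by (intro mult_nonpos_nonneg) auto
    then have "(height m1 - height m) * t + (height m2 - height m) * s \<le> 0"
      using ust by (simp add: distrib_right)
    then have h: "t * height m1 + s * height m2 \<le> (s + t) * height m" by (simp add: algebra_simps)
    have "(\<Sum>w\<in>nb v. jump v w * min_height w)
      = t / (s + t) * min_height (psi m1) + s / (s + t) * min_height (psi m2)"
      unfolding m(1)[symmetric] nb using j by simp
    also have "\<dots> \<le> t / (s + t) * height m1 + s / (s + t) * height m2"
      using ust by (intro add_mono mult_left_mono min_height_le) auto
    also have "\<dots> = (t * height m1 + s * height m2) / (s + t)" by (simp add: add_divide_distrib)
    also have "\<dots> \<le> height m" using h ust by (simp add: pos_divide_le_eq mult.commute)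
    finally show ?thesis using m by simp
  qed
  have "return_prob jump nb v = 1" if "v \<in> V" for v
    using finite_sublevel super that
    by (intro lyapunov_recurrence[where h = min_height and A = "psi ` {m. cmod (pos_of m) \<le> r0}"])
      (auto intro: finite_pos_of_bounded)
  then show ?thesis by (simp add: tgraph_walk_recurrent_def)
qed

end

theorem mainTheorem6:
  fixes pa pb pc :: real and lam :: complex
  assumes "0 < pa" "pa < 1" "0 < pb" "pb < 1" "0 < pc" "pc < 1"
    and "pa + pb + pc = 1"
    and "cmod lam = 1"
    and "nondegenerate_tgraph pa pb pc lam"
  shows "tgraph_walk_recurrent pa pb pc lam"
proof -
  interpret nondegenerate pa pb pc lam
    using assms by unfold_locales
  show ?thesis by (rule recurrent)
qed

end
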